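(* Let $G=(V,E)$ be a proper interval graph on $n$ vertices and $k>0$ an integer. Consider the following algorithm: sort the vertices as $v_0<v_1<\cdots<v_{n-1}$ (with respect to the order defined below for a proper interval representation of $G$); color each $v_i$ with color $i \bmod k\in\{0,\dots,k-1\}$; if some color class contains a cycle (in the subgraph it induces), output NO, otherwise output YES. Then this algorithm runs in $O(|V|+|E|)$ time, it outputs YES if and only if $G$ admits an equitable tree-$k$-coloring, and when it outputs YES the coloring it constructs is an equitable tree-$k$-coloring of $G$.
   Context: All graphs are finite, simple and undirected. An equitable tree-$k$-coloring of $G$ (with colors $\{0,\dots,k-1\}$) is a map $c:V(G)\to\{0,\dots,k-1\}$ such that each color class induces a forest and any two color classes differ in size by at most one. A proper interval graph is a graph with an interval representation $\{T_v=[L(v),R(v)]\}$ (distinct $u,v$ adjacent iff $T_u\cap T_v\ne\emptyset$) in which no interval properly contains another. For such a representation, $u<v$ means $L(u)<L(v)$, or $L(u)=L(v)$ and $R(u)\le R(v)$. *)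

theory Defs
  imports Complex_Main
begin

definition simple_graph :: "'a set \<Rightarrow> 'a set set \<Rightarrow> bool" where
  "simple_graph V E \<longleftrightarrow> finite V \<and> (\<forall>e\<in>E. e \<subseteq> V \<and> card e = 2)"

definition induced_edges :: "'a set set \<Rightarrow> 'a set \<Rightarrow> 'a set set" where
  "induced_edges E S = {e \<in> E. e \<subseteq> S}"

definition is_cycle :: "'a set set \<Rightarrow> 'a list \<Rightarrow> bool" where
  "is_cycle E p \<longleftrightarrow> length p \<ge> 3 \<and> distinct p \<and>
     (\<forall>i<length p. {p ! i, p ! (Suc i mod length p)} \<in> E)"

definition has_cycle :: "'a set set \<Rightarrow> bool" where
  "has_cycle E \<longleftrightarrow> (\<exists>p. is_cycle E p)"

definition color_class :: "'a set \<Rightarrow> ('a \<Rightarrow> nat) \<Rightarrow> nat \<Rightarrow> 'a set" where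
  "color_class V c j = {v \<in> V. c v = j}"

definition equitable_tree_coloring ::
  "'a set \<Rightarrow> 'a set set \<Rightarrow> nat \<Rightarrow> ('a \<Rightarrow> nat) \<Rightarrow> bool" where
  "equitable_tree_coloring V E k c \<longleftrightarrow>
     (\<forall>v\<in>V. c v < k) \<and>
     (\<forall>j<k. \<not> has_cycle (induced_edges E (color_class V c j))) \<and>
     (\<forall>i<k. \<forall>j<k. card (color_class V c i) \<le> card (color_class V c j) + 1)"

definition proper_interval_rep ::
  "'a set \<Rightarrow> 'a set set \<Rightarrow> ('a \<Rightarrow> real) \<Rightarrow> ('a \<Rightarrow> real) \<Rightarrow> bool" where
  "proper_interval_rep V E L R \<longleftrightarrow>
     (\<forall>v\<in>V. L v \<le> R v) \<and>
     (\<forall>u\<in>V. \<forall>v\<in>V. u \<noteq> v \<longrightarrow> ({u, v} \<in> E \<longleftrightarrow> {L u..R u} \<inter> {L v..R v} \<noteq> {})) \<and>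
     (\<forall>u\<in>V. \<forall>v\<in>V. \<not> {L u..R u} \<subset> {L v..R v})"

definition proper_interval_graph :: "'a set \<Rightarrow> 'a set set \<Rightarrow> bool" where
  "proper_interval_graph V E \<longleftrightarrow> simple_graph V E \<and> (\<exists>L R. proper_interval_rep V E L R)"

text \<open>Distinct vertices may have equal intervals; such vertices precede each other, so a
  sorted enumeration of the vertices need not be unique.\<close>

definition interval_less :: "('a \<Rightarrow> real) \<Rightarrow> ('a \<Rightarrow> real) \<Rightarrow> 'a \<Rightarrow> 'a \<Rightarrow> bool" where
  "interval_less L R u v \<longleftrightarrow> L u < L v \<or> (L u = L v \<and> R u \<le> R v)"

definition interval_sorted :: "'a set \<Rightarrow> 'a set set \<Rightarrow> 'a list \<Rightarrow> bool" where
  "interval_sorted V E vs \<longleftrightarrow> distinct vs \<and> set vs = V \<and>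
     (\<exists>L R. proper_interval_rep V E L R \<and> sorted_wrt (interval_less L R) vs)"

text \<open>The algorithm as a relation between the input \<open>V\<close>, \<open>E\<close>, \<open>k\<close> and the results of its
  three steps: the sorted vertices \<open>vs\<close>, the colouring \<open>c\<close> (relevant only on \<open>V\<close>) and the
  answer. It is a relation because the representation and the order of vertices with equal
  intervals are left open.\<close>

definition algorithm_run ::
  "'a set \<Rightarrow> 'a set set \<Rightarrow> nat \<Rightarrow> 'a list \<Rightarrow> ('a \<Rightarrow> nat) \<Rightarrow> bool \<Rightarrow> bool" where
  "algorithm_run V E k vs c yes \<longleftrightarrow>
     interval_sorted V E vs \<and>
     (\<forall>i<length vs. c (vs ! i) = i mod k) \<and>
     (yes \<longleftrightarrow> \<not> (\<exists>j<k. has_cycle (induced_edges E (color_class V c j))))"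

text \<open>Running time is measured on a random access machine, presented as a while language over
  named arrays of natural numbers; a scalar variable is cell 0 of an array. Each operator,
  constant and memory access costs one unit. Addition and truncated subtraction are the only
  arithmetic operations.\<close>

type_synonym vname = string
type_synonym state = "vname \<Rightarrow> nat \<Rightarrow> nat"

datatype aexp = N nat | Read vname aexp | Plus aexp aexp | Minus aexp aexp

datatype bexp = Less aexp aexp | Not bexp | And bexp bexp

datatype com =
    Skip
  | Store vname aexp aexp
  | Seq com com
  | If bexp com com
  | While bexp com

fun aval :: "aexp \<Rightarrow> state \<Rightarrow> nat" where
  "aval (N m) s = m"
| "aval (Read x a) s = s x (aval a s)"
| "aval (Plus a b) s = aval a s + aval b s"
| "aval (Minus a b) s = aval a s - aval b s"

fun acost :: "aexp \<Rightarrow> nat" where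
  "acost (N m) = 1"
| "acost (Read x a) = 1 + acost a"
| "acost (Plus a b) = 1 + acost a + acost b"
| "acost (Minus a b) = 1 + acost a + acost b"

fun bval :: "bexp \<Rightarrow> state \<Rightarrow> bool" where
  "bval (Less a b) s = (aval a s < aval b s)"
| "bval (Not b) s = (\<not> bval b s)"
| "bval (And b b') s = (bval b s \<and> bval b' s)"

fun bcost :: "bexp \<Rightarrow> nat" where
  "bcost (Less a b) = 1 + acost a + acost b"
| "bcost (Not b) = 1 + bcost b"
| "bcost (And b b') = 1 + bcost b + bcost b'"

definition store :: "state \<Rightarrow> vname \<Rightarrow> nat \<Rightarrow> nat \<Rightarrow> state" where
  "store s x i m = s(x := (s x)(i := m))"

text \<open>\<open>exec p s t s'\<close>: started in \<open>s\<close>, the program \<open>p\<close> terminates in \<open>s'\<close> at cost \<open>t\<close>.\<close>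

inductive exec :: "com \<Rightarrow> state \<Rightarrow> nat \<Rightarrow> state \<Rightarrow> bool" where
  Skip: "exec Skip s 1 s"
| Store: "exec (Store x a b) s (1 + acost a + acost b) (store s x (aval a s) (aval b s))"
| Seq: "exec p s t1 s1 \<Longrightarrow> exec q s1 t2 s2 \<Longrightarrow> exec (Seq p q) s (t1 + t2) s2"
| IfTrue: "bval b s \<Longrightarrow> exec p s t s' \<Longrightarrow> exec (If b p q) s (bcost b + t) s'"
| IfFalse: "\<not> bval b s \<Longrightarrow> exec q s t s' \<Longrightarrow> exec (If b p q) s (bcost b + t) s'"
| WhileFalse: "\<not> bval b s \<Longrightarrow> exec (While b p) s (bcost b) s"
| WhileTrue: "bval b s \<Longrightarrow> exec p s t1 s1 \<Longrightarrow> exec (While b p) s1 t2 s2 \<Longrightarrow>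
    exec (While b p) s (bcost b + t1 + t2) s2"

inductive_cases exec_SkipE: "exec Skip s t s'"
  and exec_StoreE: "exec (Store x a b) s t s'"
  and exec_SeqE: "exec (Seq p q) s t s'"
  and exec_IfE: "exec (If b p q) s t s'"
  and exec_WhileE: "exec (While b p) s t s'"

lemma exec_deterministic: "exec p s t s' \<Longrightarrow> exec p s u s'' \<Longrightarrow> u = t \<and> s'' = s'"
proof (induction arbitrary: u s'' rule: exec.induct)
  case (Seq p s t1 s1 q t2 s2)
  from Seq.prems obtain u1 r1 u2 where
    "exec p s u1 r1" "exec q r1 u2 s''" "u = u1 + u2"
    by (rule exec_SeqE)
  with Seq.IH show ?case by blast
next
  case (WhileFalse b s p)
  from WhileFalse.prems show ?case
    by (rule exec_WhileE) (use WhileFalse.hyps in simp_all)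
next
  case (WhileTrue b s p t1 s1 t2 s2)
  from WhileTrue.prems obtain u1 r1 u2 where
    "exec p s u1 r1" "exec (While b p) r1 u2 s''" "u = bcost b + u1 + u2"
    by (rule exec_WhileE) (use WhileTrue.hyps in simp_all)
  with WhileTrue.IH show ?case by blast
next
  case (IfTrue b s p t s' q)
  from IfTrue.prems show ?case
    by (rule exec_IfE) (use IfTrue.hyps IfTrue.IH in blast)+
next
  case (IfFalse b s q t s' p)
  from IfFalse.prems show ?case
    by (rule exec_IfE) (use IfFalse.hyps IfFalse.IH in blast)+
qed (auto elim: exec_SkipE exec_StoreE)

text \<open>The input is the graph, given by adjacency lists, together with \<open>k\<close>. Vertices are numbered
  by an arbitrary bijection \<open>e\<close> from \<open>{..<card V}\<close> to \<open>V\<close>. The numbers of the neighbours of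
  \<open>e i\<close> are listed without repetition, in any order, in the cells \<open>off[i], \<dots>, off[i+1] - 1\<close> of
  \<open>adj\<close>. No interval representation is supplied, and the initial contents of all other memory
  cells are arbitrary.\<close>

definition stores_input ::
  "'a set \<Rightarrow> 'a set set \<Rightarrow> nat \<Rightarrow> (nat \<Rightarrow> 'a) \<Rightarrow> state \<Rightarrow> bool" where
  "stores_input V E k e s \<longleftrightarrow>
     bij_betw e {..<card V} V \<and>
     s ''n'' 0 = card V \<and> s ''k'' 0 = k \<and> s ''off'' 0 = 0 \<and>
     (\<forall>i<card V. s ''off'' i \<le> s ''off'' (Suc i) \<and>
        bij_betw (s ''adj'') {s ''off'' i..<s ''off'' (Suc i)}
          {j. j < card V \<and> {e i, e j} \<in> E})"

definition stores_output ::
  "(nat \<Rightarrow> 'a) \<Rightarrow> 'a list \<Rightarrow> ('a \<Rightarrow> nat) \<Rightarrow> bool \<Rightarrow> state \<Rightarrow> bool" where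
  "stores_output e vs c yes s \<longleftrightarrow>
     (\<forall>i<length vs. s ''order'' i < length vs \<and> e (s ''order'' i) = vs ! i) \<and>
     (\<forall>i<length vs. s ''color'' i = c (e i)) \<and>
     s ''answer'' 0 = (if yes then 1 else 0)"

end

theory Submission
  imports Defs
begin

text \<open>
  In a proper interval graph every vertex is adjacent to all vertices between itself and any of
  its neighbours. So a cycle in a class of the colouring \<open>i mod k\<close>, seen from its first vertex
  \<open>v\<^sub>i\<close>, yields the edge \<open>v\<^sub>i v\<^sub>i\<^sub>+\<^sub>2\<^sub>k\<close>. This edge makes \<open>v\<^sub>i, \<dots>, v\<^sub>i\<^sub>+\<^sub>2\<^sub>k\<close> a clique, and
  then no tree colouring with \<open>k\<close> colours exists.

  An order of the vertices is found in linear time without an interval representation. A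
  breadth-first search from any vertex of a component finds an end \<open>w\<close> of it, up to twins: a vertex
  of least degree among the children of the last vertex that has children. A second search from
  \<open>w\<close> need not give an interval order, but it puts nonadjacent vertices in the right order.
  That suffices to compute the positions of the first and last vertex of every closed
  neighbourhood, and counting sort by the sum of these two positions gives an interval order,
  because vertices with the same sum are twins. The edges \<open>v\<^sub>i v\<^sub>i\<^sub>+\<^sub>2\<^sub>k\<close> are read off from the last
  positions.
\<close>

section \<open>Interval orders and cyclic colourings\<close>

text \<open>The umbrella condition, in the forms \<open>umbrella_free\<close> for lists and
  \<open>umbrella\<close> for numberings, is all that is used of an interval order. Intervals are
  attached to the finished list only because the specification asks for them. The search order may
  misplace adjacent vertices, so it is not an umbrella order itself. It is still good enough because
  the set of earlier nonneighbours of a vertex depends only on the order of nonadjacent pairs; its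
  size and the degree fix both ends of the closed neighbourhood. The main obstacle is that the
  interval order followed by the search is never known. Each component can be reversed on its own,
  and the direction is settled only when the search has chosen an end. Hence this order stays
  existentially quantified, is replaced whenever a component is finished, and takes integer values
  so that it can be negated and shifted. For the running time, the sums to be sorted are at most
  twice the number of vertices, and a potential charges the searches to the vertices and edges of
  their own component.\<close>

definition umbrella_free :: "'a set set \<Rightarrow> 'a list \<Rightarrow> bool" where
  "umbrella_free E vs \<longleftrightarrow> (\<forall>i j l. i < j \<and> j < l \<and> l < length vs \<and> {vs ! i, vs ! l} \<in> E \<longrightarrow>
     {vs ! i, vs ! j} \<in> E \<and> {vs ! j, vs ! l} \<in> E)"

lemma umbrella_freeD:
  assumes "umbrella_free E vs" "i < j" "j < l" "l < length vs" "{vs ! i, vs ! l} \<in> E"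
  shows "{vs ! i, vs ! j} \<in> E" "{vs ! j, vs ! l} \<in> E"
  using assms unfolding umbrella_free_def by blast+

text \<open>Properness orders the right ends like the left ends: as \<open>L u \<le> L v\<close>,
  having \<open>R v < R u\<close> would put the interval of \<open>v\<close> properly inside that of
  \<open>u\<close>. The edge \<open>{u, w}\<close> gives \<open>L w \<le> R u\<close>, so
  \<open>L v\<close> is common to the intervals of \<open>u\<close> and \<open>v\<close>, and
  \<open>L w\<close> to those of \<open>v\<close> and \<open>w\<close>.\<close>

lemma proper_interval_rep_umbrella:
  assumes rep: "proper_interval_rep V E L R" and V: "u \<in> V" "v \<in> V" "w \<in> V"
    and ne: "u \<noteq> v" "v \<noteq> w" "u \<noteq> w"
    and less: "interval_less L R u v" "interval_less L R v w" and uw: "{u, w} \<in> E"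
  shows "{u, v} \<in> E \<and> {v, w} \<in> E"
proof -
  have adj: "{x, y} \<in> E \<longleftrightarrow> {L x..R x} \<inter> {L y..R y} \<noteq> {}"
    if "x \<in> V" "y \<in> V" "x \<noteq> y" for x y
    using rep that unfolding proper_interval_rep_def by blast
  have LR: "L x \<le> R x" if "x \<in> V" for x
    using rep that unfolding proper_interval_rep_def by blast
  have L: "L u \<le> L v" "L v \<le> L w"
    using less by (auto simp: interval_less_def)
  have "\<not> {L v..R v} \<subset> {L u..R u}"
    using rep V unfolding proper_interval_rep_def by blast
  then have R: "R u \<le> R v"
    using L LR[OF V(1)] LR[OF V(2)] by (auto simp: psubset_eq not_le)
  obtain x where "x \<in> {L u..R u}" "x \<in> {L w..R w}"
    using adj[OF V(1,3) ne(3)] uw by blast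
  then have Lw: "L w \<le> R u" by simp
  have "L v \<in> {L u..R u} \<inter> {L v..R v}" "L w \<in> {L v..R v} \<inter> {L w..R w}"
    using L R Lw LR[OF V(2)] LR[OF V(3)] by auto
  then show ?thesis
    using adj V ne by blast
qed

lemma interval_sorted_umbrella_free:
  assumes "interval_sorted V E vs"
  shows "umbrella_free E vs"
  unfolding umbrella_free_def
proof (intro allI impI)
  fix i j l
  assume a: "i < j \<and> j < l \<and> l < length vs \<and> {vs ! i, vs ! l} \<in> E"
  obtain L R where rep: "proper_interval_rep V E L R" and srt: "sorted_wrt (interval_less L R) vs"
    and d: "distinct vs" and V: "set vs = V"
    using assms unfolding interval_sorted_def by blast
  have "vs ! i \<in> V" "vs ! j \<in> V" "vs ! l \<in> V" "vs ! i \<noteq> vs ! j" "vs ! j \<noteq> vs ! l" "vs ! i \<noteq> vs ! l"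
    using a V d by (auto simp: nth_eq_iff_index_eq)
  moreover have "interval_less L R (vs ! i) (vs ! j)" "interval_less L R (vs ! j) (vs ! l)"
    using srt a by (auto simp: sorted_wrt_iff_nth_less)
  ultimately show "{vs ! i, vs ! j} \<in> E \<and> {vs ! j, vs ! l} \<in> E"
    using proper_interval_rep_umbrella[OF rep] a by blast
qed

text \<open>The vertex at position \<open>i\<close> gets an interval from \<open>i\<close> to just
  beyond \<open>r i\<close>, the last position in its closed neighbourhood. The extra
  \<open>i / (n + 1)\<close>, with \<open>n\<close> the length of the list, makes the right ends
  strictly increasing, which excludes proper containment, and is below 1, so no further left end is
  reached.\<close>

lemma umbrella_free_interval_sorted:
  assumes d: "distinct vs" and V: "set vs = V" and u: "umbrella_free E vs"
  shows "interval_sorted V E vs"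
proof -
  let ?n = "length vs"
  define r where "r i = Max {j. j < ?n \<and> (j = i \<or> {vs ! i, vs ! j} \<in> E)}" for i
  have fin: "finite {j. j < ?n \<and> (j = i \<or> {vs ! i, vs ! j} \<in> E)}" for i by simp
  have r_ge: "j \<le> r i" if "j < ?n" "j = i \<or> {vs ! i, vs ! j} \<in> E" for i j
    unfolding r_def using fin that by (intro Max_ge) auto
  have r_in: "r i < ?n \<and> (r i = i \<or> {vs ! i, vs ! r i} \<in> E)" if "i < ?n" for i
    using Max_in[OF fin[of i]] that unfolding r_def by blast
  have adj: "{vs ! i, vs ! j} \<in> E \<longleftrightarrow> j \<le> r i" if "i < j" "j < ?n" for i j
  proof
    assume "j \<le> r i"
    then show "{vs ! i, vs ! j} \<in> E"
      using r_in[of i] that umbrella_freeD(1)[OF u, of i j "r i"]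
      by (cases "j = r i") auto
  qed (use r_ge that in blast)
  have r_mono: "r i \<le> r j" if "i \<le> j" "j < ?n" for i j
  proof (cases "r i \<le> j")
    case True
    then show ?thesis using r_ge[of j j] that by simp
  next
    case False
    then show ?thesis
      using r_in[of i] that umbrella_freeD(2)[OF u, of i j "r i"] r_ge[of "r i" j]
      by (cases "i = j") auto
  qed
  define pos where "pos v = (THE i. i < ?n \<and> vs ! i = v)" for v
  have pos: "pos (vs ! i) = i" if "i < ?n" for i
    unfolding pos_def using that d by (intro the_equality) (auto simp: nth_eq_iff_index_eq)
  define L where "L v = real (pos v)" for v
  define R where "R v = real (r (pos v)) + real (pos v) / real (?n + 1)" for v
  have frac: "real i / (1 + real ?n) < 1" if "i < ?n" for i
    using that by simp
  have R_less: "R (vs ! i) < R (vs ! j)" if "i < j" "j < ?n" for i j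
  proof -
    have "real i / real (?n + 1) < real j / real (?n + 1)"
      using that by (intro divide_strict_right_mono) auto
    then show ?thesis
      using r_mono[of i j] that by (simp add: R_def pos)
  qed
  have LR: "L (vs ! i) \<le> R (vs ! i)" if "i < ?n" for i
    using r_ge[of i i] that by (simp add: L_def R_def pos add_increasing2)
  have meet: "{vs ! i, vs ! j} \<in> E \<longleftrightarrow> {L (vs ! i)..R (vs ! i)} \<inter> {L (vs ! j)..R (vs ! j)} \<noteq> {}"
    if "i < j" "j < ?n" for i j
  proof -
    have LL: "L (vs ! i) \<le> L (vs ! j)" using that by (simp add: L_def pos)
    have "{L (vs ! i)..R (vs ! i)} \<inter> {L (vs ! j)..R (vs ! j)} \<noteq> {} \<longleftrightarrow> L (vs ! j) \<le> R (vs ! i)"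
    proof
      assume "L (vs ! j) \<le> R (vs ! i)"
      then have "L (vs ! j) \<in> {L (vs ! i)..R (vs ! i)} \<inter> {L (vs ! j)..R (vs ! j)}"
        using LL LR[of j] that by simp
      then show "{L (vs ! i)..R (vs ! i)} \<inter> {L (vs ! j)..R (vs ! j)} \<noteq> {}" by blast
    qed auto
    also have "\<dots> \<longleftrightarrow> j \<le> r i"
    proof
      assume "L (vs ! j) \<le> R (vs ! i)"
      then have "real j \<le> real (r i) + real i / (1 + real ?n)"
        using that by (simp add: L_def R_def pos)
      then have "real j < real (r i) + 1"
        using frac[OF order.strict_trans[OF that]] by linarith
      then show "j \<le> r i" by linarith
    next
      assume "j \<le> r i"
      then show "L (vs ! j) \<le> R (vs ! i)"
        using that by (simp add: L_def R_def pos add_increasing2)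
    qed
    finally show ?thesis using adj[OF that] by simp
  qed
  have "proper_interval_rep V E L R"
    unfolding proper_interval_rep_def
  proof (intro conjI ballI impI)
    fix v assume "v \<in> V"
    then show "L v \<le> R v" using LR V by (auto simp: in_set_conv_nth)
  next
    fix v w assume "v \<in> V" "w \<in> V" "v \<noteq> w"
    then obtain i j where ij: "i < ?n" "j < ?n" "v = vs ! i" "w = vs ! j" "i \<noteq> j"
      using V by (metis in_set_conv_nth)
    show "{v, w} \<in> E \<longleftrightarrow> {L v..R v} \<inter> {L w..R w} \<noteq> {}"
    proof (cases "i < j")
      case True
      then show ?thesis using meet ij by simp
    next
      case False
      then show ?thesis using meet[of j i] ij by (simp add: insert_commute Int_commute)
    qed
  next
    fix v w assume vw: "v \<in> V" "w \<in> V"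
    then obtain i j where ij: "i < ?n" "j < ?n" "v = vs ! i" "w = vs ! j"
      using V by (metis in_set_conv_nth)
    show "\<not> {L v..R v} \<subset> {L w..R w}"
    proof
      assume sub: "{L v..R v} \<subset> {L w..R w}"
      then have "L w \<le> L v" "R v \<le> R w"
        using LR[of i] ij by (auto simp: psubset_eq)
      then have "j \<le> i" "\<not> R (vs ! j) < R (vs ! i)"
        using ij by (auto simp: L_def pos)
      then have "i = j" using R_less[of j i] ij by force
      then show False using sub ij by simp
    qed
  qed
  moreover have "sorted_wrt (interval_less L R) vs"
    by (auto simp: sorted_wrt_iff_nth_less interval_less_def L_def pos)
  ultimately show ?thesis
    using d V unfolding interval_sorted_def by blast
qed

section \<open>Residue classes as colour classes: sizes, cycles and forced triangles\<close>

text \<open>Every element of class \<open>i\<close> other than \<open>i\<close> itself has the form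
  \<open>q * k + k + i\<close> and is the image of \<open>q * k + j\<close> in class
  \<open>j\<close>.\<close>

lemma mod_classes_balanced:
  fixes i j k n :: nat
  assumes "j < k"
  shows "card {x. x < n \<and> x mod k = i} \<le> card {x. x < n \<and> x mod k = j} + 1"
proof (cases "i < k")
  case True
  let ?S = "\<lambda>i. {x. x < n \<and> x mod k = i}"
  have "?S i \<subseteq> insert i ((\<lambda>x. x - j + k + i) ` ?S j)"
  proof
    fix x assume x: "x \<in> ?S i"
    show "x \<in> insert i ((\<lambda>x. x - j + k + i) ` ?S j)"
    proof (cases "x = i")
      case False
      have "x = x div k * k + i" using x by (metis (mono_tags) div_mult_mod_eq mem_Collect_eq)
      then have "x div k \<noteq> 0" using False by (metis add_0 mult_0)
      then obtain q where "x div k = Suc q" by (cases "x div k") auto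
      with \<open>x = x div k * k + i\<close> have q: "x = q * k + k + i" by simp
      have "q * k + j \<in> ?S j" using q x assms by auto
      moreover have "x = q * k + j - j + k + i" using q by simp
      ultimately show ?thesis by blast
    qed simp
  qed
  then have "card (?S i) \<le> card (insert i ((\<lambda>x. x - j + k + i) ` ?S j))"
    by (intro card_mono) auto
  also have "\<dots> \<le> Suc (card ((\<lambda>x. x - j + k + i) ` ?S j))"
    by (rule card_insert_le_m1) simp_all
  also have "\<dots> \<le> card (?S j) + 1"
    using card_image_le[of "?S j"] by simp
  finally show ?thesis .
next
  case False
  then have none: "{x. x < n \<and> x mod k = i} = {}" using assms by auto
  show ?thesis unfolding none by simp
qed

lemma triangle_has_cycle:
  assumes "x \<noteq> y" "y \<noteq> z" "x \<noteq> z" "{x, y} \<in> E" "{y, z} \<in> E" "{x, z} \<in> E"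
  shows "has_cycle E"
proof -
  have "{z, x} \<in> E" using assms(6) by (simp add: insert_commute)
  then have "is_cycle E [x, y, z]"
    using assms unfolding is_cycle_def by (simp add: All_less_Suc)
  then show ?thesis unfolding has_cycle_def by blast
qed

text \<open>The two are successor and predecessor along the cycle, which differ because its length
  is at least 3.\<close>

lemma is_cycle_two_neighbours:
  assumes c: "is_cycle E p" and x: "x \<in> set p"
  obtains y z where "y \<in> set p" "z \<in> set p" "y \<noteq> z" "x \<noteq> y" "x \<noteq> z" "{x, y} \<in> E" "{x, z} \<in> E"
proof -
  let ?l = "length p"
  have l: "?l \<ge> 3" and d: "distinct p" and e: "\<And>i. i < ?l \<Longrightarrow> {p ! i, p ! (Suc i mod ?l)} \<in> E"
    using c unfolding is_cycle_def by auto
  obtain i where i: "i < ?l" "x = p ! i" using x by (metis in_set_conv_nth)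
  define a where "a = Suc i mod ?l"
  define b where "b = (if i = 0 then ?l - 1 else i - 1)"
  have "0 < ?l" using l by linarith
  then have a: "a < ?l" "a = (if Suc i = ?l then 0 else Suc i)" using i by (auto simp: a_def)
  have b: "b < ?l" "Suc b mod ?l = i" using i l by (auto simp: b_def)
  have "a \<noteq> b" "i \<noteq> a" "i \<noteq> b" using a i l by (auto simp: b_def)
  then have "p ! a \<noteq> p ! b" "x \<noteq> p ! a" "x \<noteq> p ! b"
    using a(1) b(1) i d by (auto simp: nth_eq_iff_index_eq)
  moreover have "{x, p ! a} \<in> E" using e[of i] i by (simp add: a_def)
  moreover have "{x, p ! b} \<in> E" using e[of b] b i by (simp add: insert_commute)
  ultimately show ?thesis using that a(1) b(1) nth_mem by blast
qed

text \<open>The umbrella property is assumed instead of a representation, so that the results apply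
  both to an arbitrary sorted enumeration and to the order that the program computes.\<close>

locale cyclic_coloring =
  fixes V :: "'a set" and E vs k and c :: "'a \<Rightarrow> nat"
  assumes simple: "simple_graph V E" and k: "k > 0"
    and d: "distinct vs" and V: "set vs = V" and u: "umbrella_free E vs"
    and c: "\<And>i. i < length vs \<Longrightarrow> c (vs ! i) = i mod k"
begin

lemma color_class: "color_class V c j = (\<lambda>i. vs ! i) ` {i. i < length vs \<and> i mod k = j}"
  using V c unfolding color_class_def by (auto simp: in_set_conv_nth)

text \<open>At most one of the two cycle neighbours of the first vertex, at position
  \<open>m\<close>, can be at \<open>m + k\<close>. The other is at \<open>m + 2 * k\<close> or
  later, and the umbrella property pulls its edge back to \<open>m + 2 * k\<close>. Conversely, such
  an edge closes a triangle on \<open>i\<close>, \<open>i + k\<close>,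
  \<open>i + 2 * k\<close>.\<close>

lemma has_cycle_iff:
  "(\<exists>j<k. has_cycle (induced_edges E (color_class V c j))) \<longleftrightarrow>
   (\<exists>i. i + 2 * k < length vs \<and> {vs ! i, vs ! (i + 2 * k)} \<in> E)"
proof
  assume "\<exists>j<k. has_cycle (induced_edges E (color_class V c j))"
  then obtain j p where p: "is_cycle (induced_edges E (color_class V c j)) p"
    unfolding has_cycle_def by blast
  let ?I = "{i. i < length vs \<and> i mod k = j}"
  \<comment> \<open>Each vertex of the cycle inherits membership in the class from an induced edge
    at it.\<close>
  have cls: "x \<in> (\<lambda>i. vs ! i) ` ?I" if "x \<in> set p" for x
    by (rule is_cycle_two_neighbours[OF p that]) (auto simp: induced_edges_def color_class)
  define P where "P = {i \<in> ?I. vs ! i \<in> set p}"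
  have "p \<noteq> []" using p by (auto simp: is_cycle_def)
  then have hd: "hd p \<in> set p" by simp
  then obtain i where "i \<in> ?I" "vs ! i = hd p" using cls[OF hd] by force
  then have "P \<noteq> {}" using hd by (auto simp: P_def)
  moreover have fin: "finite P" by (simp add: P_def)
  ultimately obtain m where m: "m \<in> P" "\<And>i. i \<in> P \<Longrightarrow> m \<le> i"
    using Min_in Min_le by metis
  then have "vs ! m \<in> set p" by (simp add: P_def)
  then obtain y z where yz: "y \<in> set p" "z \<in> set p" "y \<noteq> z" "vs ! m \<noteq> y" "vs ! m \<noteq> z"
      "{vs ! m, y} \<in> E" "{vs ! m, z} \<in> E"
    by (rule is_cycle_two_neighbours[OF p]) (auto simp: induced_edges_def)
  obtain a b where ab: "a \<in> ?I" "b \<in> ?I" "y = vs ! a" "z = vs ! b"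
    using cls yz by blast
  have "m \<le> a" "m \<le> b" using ab yz m(2) by (auto simp: P_def)
  have far: "{vs ! m, vs ! (m + 2 * k)} \<in> E \<and> m + 2 * k < length vs"
    if "b \<in> ?I" "m \<le> b" "b \<noteq> m" "b \<noteq> m + k" "{vs ! m, vs ! b} \<in> E" for b
  proof -
    have "b mod k = m mod k" using that m(1) by (simp add: P_def)
    then have "k dvd b - m" using that(2) by (simp add: mod_eq_dvd_iff_nat)
    then obtain q where "b - m = k * q" by (rule dvdE)
    then have q: "b = m + k * q" using that(2) by simp
    with that have "q \<noteq> 0" "q \<noteq> 1" by auto
    then have "2 \<le> q" by simp
    then have "k * 2 \<le> k * q" by simp
    then have "m + 2 * k \<le> b" using q by simp
    then show ?thesis
      using umbrella_freeD(1)[OF u, of m "m + 2 * k" b] that k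
      by (cases "b = m + 2 * k") auto
  qed
  have "a \<noteq> b" "a \<noteq> m" "b \<noteq> m" using yz ab by auto
  then show "\<exists>i. i + 2 * k < length vs \<and> {vs ! i, vs ! (i + 2 * k)} \<in> E"
    using far[of a] far[of b] ab yz \<open>m \<le> a\<close> \<open>m \<le> b\<close> by (cases "a = m + k") auto
next
  assume "\<exists>i. i + 2 * k < length vs \<and> {vs ! i, vs ! (i + 2 * k)} \<in> E"
  then obtain i where i: "i + 2 * k < length vs" "{vs ! i, vs ! (i + 2 * k)} \<in> E" by blast
  have e: "{vs ! i, vs ! (i + k)} \<in> E" "{vs ! (i + k), vs ! (i + 2 * k)} \<in> E"
    using umbrella_freeD[OF u, of i "i + k" "i + 2 * k"] i k by auto
  have "vs ! x \<in> color_class V c (i mod k)" if "x < length vs" "x mod k = i mod k" for x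
    using that by (auto simp: color_class)
  then have "vs ! i \<in> color_class V c (i mod k)" "vs ! (i + k) \<in> color_class V c (i mod k)"
    "vs ! (i + 2 * k) \<in> color_class V c (i mod k)"
    using i by auto
  then have "has_cycle (induced_edges E (color_class V c (i mod k)))"
    using e i k d
    by (intro triangle_has_cycle[of "vs ! i" "vs ! (i + k)" "vs ! (i + 2 * k)"])
      (auto simp: induced_edges_def nth_eq_iff_index_eq)
  then show "\<exists>j<k. has_cycle (induced_edges E (color_class V c j))"
    using k by (meson mod_less_divisor)
qed

lemma balanced:
  assumes "i < k" "j < k"
  shows "card (color_class V c i) \<le> card (color_class V c j) + 1"
proof -
  have "card (color_class V c j) = card {x. x < length vs \<and> x mod k = j}" for j
    unfolding color_class by (intro card_image inj_on_nth[OF d]) blast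
  then show ?thesis using mod_classes_balanced[OF assms(2)] by simp
qed

text \<open>A clique on \<open>2 * k + 1\<close> consecutive vertices forces a monochromatic triangle in every
  colouring with \<open>k\<close> colours.\<close>

lemma no_tree_coloring:
  assumes i: "i + 2 * k < length vs" "{vs ! i, vs ! (i + 2 * k)} \<in> E"
  shows "\<not> equitable_tree_coloring V E k c'"
proof
  assume c': "equitable_tree_coloring V E k c'"
  let ?I = "{i..i + 2 * k}"
  have clique: "{vs ! a, vs ! b} \<in> E" if "a \<in> ?I" "b \<in> ?I" "a \<noteq> b" for a b
  proof -
    have *: "{vs ! a, vs ! b} \<in> E" if "a \<in> ?I" "b \<in> ?I" "a < b" for a b
    proof -
      have "{vs ! i, vs ! b} \<in> E"
        using umbrella_freeD(1)[OF u, of i b "i + 2 * k"] i that by (cases "b = i + 2 * k") auto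
      then show ?thesis
        using umbrella_freeD(2)[OF u, of i a b] i that by (cases "a = i") auto
    qed
    show ?thesis using *[of a b] *[of b a] that by (cases "a < b") (auto simp: insert_commute)
  qed
  have lt: "c' (vs ! a) < k" if "a \<in> ?I" for a
    using c' that V i unfolding equitable_tree_coloring_def by auto
  \<comment> \<open>Pigeonhole: \<open>k\<close> colours used at most twice each cannot cover
    \<open>2 * k + 1\<close> positions.\<close>
  have "\<exists>j<k. card {a \<in> ?I. c' (vs ! a) = j} \<ge> 3"
  proof (rule ccontr)
    assume "\<not> ?thesis"
    then have le: "card {a \<in> ?I. c' (vs ! a) = j} \<le> 2" if "j < k" for j
      using that by fastforce
    have "?I = (\<Union>j<k. {a \<in> ?I. c' (vs ! a) = j})" using lt by auto
    then have "card ?I = card (\<Union>j<k. {a \<in> ?I. c' (vs ! a) = j})" by (rule arg_cong)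
    also have "\<dots> \<le> (\<Sum>j<k. card {a \<in> ?I. c' (vs ! a) = j})"
      by (rule card_UN_le) simp
    also have "\<dots> \<le> (\<Sum>j<k. 2)" using le by (intro sum_mono) auto
    finally have "card ?I \<le> 2 * k" by simp
    then show False by simp
  qed
  then obtain j where j: "j < k" "3 \<le> card {a \<in> ?I. c' (vs ! a) = j}" by blast
  then obtain T where "T \<subseteq> {a \<in> ?I. c' (vs ! a) = j}" "card T = 3"
    by (meson obtain_subset_with_card_n)
  then obtain x y z where T: "x \<noteq> y" "y \<noteq> z" "x \<noteq> z" "x \<in> ?I" "y \<in> ?I" "z \<in> ?I"
      "c' (vs ! x) = j" "c' (vs ! y) = j" "c' (vs ! z) = j"
    by (auto simp: card_3_iff)
  then have "vs ! x \<noteq> vs ! y" "vs ! y \<noteq> vs ! z" "vs ! x \<noteq> vs ! z"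
    using d i by (auto simp: nth_eq_iff_index_eq)
  then have "has_cycle (induced_edges E (color_class V c' j))"
    using T clique V i
    by (intro triangle_has_cycle[of "vs ! x" "vs ! y" "vs ! z"])
      (auto simp: induced_edges_def color_class_def)
  then show False using c' j unfolding equitable_tree_coloring_def by blast
qed

lemma tree_coloring_iff:
  "equitable_tree_coloring V E k c \<longleftrightarrow> \<not> (\<exists>j<k. has_cycle (induced_edges E (color_class V c j)))"
proof -
  have "c v < k" if "v \<in> V" for v
    using that V c k by (metis in_set_conv_nth mod_less_divisor)
  then show ?thesis
    using balanced unfolding equitable_tree_coloring_def by simp
qed

lemma ex_tree_coloring_iff:
  "(\<exists>c'. equitable_tree_coloring V E k c') \<longleftrightarrow>
   \<not> (\<exists>j<k. has_cycle (induced_edges E (color_class V c j)))"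
proof
  assume "\<exists>c'. equitable_tree_coloring V E k c'"
  then show "\<not> (\<exists>j<k. has_cycle (induced_edges E (color_class V c j)))"
    unfolding has_cycle_iff using no_tree_coloring by blast
next
  assume "\<not> (\<exists>j<k. has_cycle (induced_edges E (color_class V c j)))"
  then show "\<exists>c'. equitable_tree_coloring V E k c'"
    using tree_coloring_iff by (intro exI[where x = c]) simp
qed

end

lemma algorithm_run_correct:
  assumes "proper_interval_graph V E" "k > 0" "algorithm_run V E k vs c yes"
  shows "yes \<longleftrightarrow> (\<exists>c'. equitable_tree_coloring V E k c')"
    and "yes \<Longrightarrow> equitable_tree_coloring V E k c"
proof -
  have run: "interval_sorted V E vs" "\<forall>i<length vs. c (vs ! i) = i mod k"
    "yes \<longleftrightarrow> \<not> (\<exists>j<k. has_cycle (induced_edges E (color_class V c j)))"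
    using assms(3) unfolding algorithm_run_def by blast+
  interpret cyclic_coloring V E vs k c
  proof
    show "simple_graph V E" using assms(1) by (simp add: proper_interval_graph_def)
    show "distinct vs" "set vs = V" using run(1) by (simp_all add: interval_sorted_def)
    show "umbrella_free E vs" by (rule interval_sorted_umbrella_free[OF run(1)])
  qed (use assms(2) run(2) in blast)+
  show "yes \<longleftrightarrow> (\<exists>c'. equitable_tree_coloring V E k c')"
    unfolding run(3) ex_tree_coloring_iff ..
  show "yes \<Longrightarrow> equitable_tree_coloring V E k c"
    unfolding run(3) tree_coloring_iff .
qed

section \<open>Orders given by breadth-first search\<close>

text \<open>The graph is transported to the numbers of its vertices, since these index the arrays of
  the program.\<close>

locale nat_graph =
  fixes n :: nat and A :: "nat \<Rightarrow> nat \<Rightarrow> bool"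
  assumes A_sym: "A u v \<Longrightarrow> A v u" and A_irrefl: "\<not> A u u" and A_less: "A u v \<Longrightarrow> u < n"
begin

lemma A_less2: "A u v \<Longrightarrow> v < n"
  using A_sym A_less by blast

section \<open>Positions of closed neighbourhoods and sorting by them\<close>

definition deg :: "nat \<Rightarrow> nat" where
  "deg v = card {u. A v u}"

lemma finite_nbrs [simp]: "finite {u. A v u}"
  by (rule finite_subset[of _ "{..<n}"]) (use A_less2 in auto)

definition umbrella :: "(nat \<Rightarrow> 'b::linorder) \<Rightarrow> bool" where
  "umbrella f \<longleftrightarrow> inj_on f {..<n} \<and>
     (\<forall>x<n. \<forall>y<n. \<forall>z<n. f x < f y \<longrightarrow> f y < f z \<longrightarrow> A x z \<longrightarrow> A x y \<and> A y z)"

definition left :: "(nat \<Rightarrow> 'b::linorder) \<Rightarrow> nat \<Rightarrow> nat set" where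
  "left f v = {u. u < n \<and> f u < f v \<and> \<not> A u v}"

definition right :: "(nat \<Rightarrow> 'b::linorder) \<Rightarrow> nat \<Rightarrow> nat set" where
  "right f v = {u. u < n \<and> f v < f u \<and> \<not> A u v}"

text \<open>If \<open>f\<close> numbers the vertices along an interval order, then the closed neighbourhood of \<open>v\<close>
  occupies the positions \<open>low f v\<close>, \dots, \<open>low f v + deg v\<close>.\<close>

definition low :: "(nat \<Rightarrow> 'b::linorder) \<Rightarrow> nat \<Rightarrow> nat" where
  "low f v = card (left f v)"

text \<open>This is \<open>low f v\<close> plus \<open>low f v + deg v\<close>; only
  \<open>low\<close> depends on the order.\<close>

definition key :: "(nat \<Rightarrow> 'b::linorder) \<Rightarrow> nat \<Rightarrow> nat" where
  "key f v = 2 * low f v + deg v"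

text \<open>Adjacent pairs are left free: this is as much as a search order shares with an interval
  order.\<close>

definition agree :: "(nat \<Rightarrow> 'b::linorder) \<Rightarrow> (nat \<Rightarrow> 'c::linorder) \<Rightarrow> bool" where
  "agree f g \<longleftrightarrow> (\<forall>x<n. \<forall>y<n. f x < f y \<longrightarrow> \<not> A x y \<longrightarrow> g x < g y)"

lemma umbrella_neq: "umbrella f \<Longrightarrow> x < n \<Longrightarrow> y < n \<Longrightarrow> x \<noteq> y \<Longrightarrow> f x < f y \<or> f y < f x"
  unfolding umbrella_def inj_on_def by (metis lessThan_iff linorder_neqE)

lemma umbrellaD:
  assumes "umbrella f" "A x z" "y < n" "f x < f y" "f y < f z"
  shows "A x y" "A y z"
  using assms A_less A_less2 unfolding umbrella_def by blast+

lemma finite_left [simp]: "finite (left f v)" and finite_right [simp]: "finite (right f v)"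
  unfolding left_def right_def by auto

text \<open>Only nonadjacent pairs enter \<open>left\<close>. Since \<open>f\<close> is injective,
  each of them is ordered by \<open>f\<close>, so \<open>g\<close> cannot order it the other way;
  this gives the converse inclusion.\<close>

lemma low_agree:
  assumes fg: "agree f g" and f: "inj_on f {..<n}" and v: "v < n"
  shows "low f v = low g v"
proof -
  have "left f v = left g v"
  proof (intro set_eqI iffI)
    fix u assume "u \<in> left f v"
    then show "u \<in> left g v" using fg v by (auto simp: left_def agree_def)
  next
    fix u assume u: "u \<in> left g v"
    then have "u \<noteq> v" by (auto simp: left_def)
    then have "f u < f v \<or> f v < f u" using f u v
      by (metis (no_types, lifting) inj_onD left_def lessThan_iff linorder_neqE mem_Collect_eq)
    moreover have "\<not> f v < f u" using fg u v A_sym by (force simp: left_def agree_def)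
    ultimately show "u \<in> left f v" using u by (auto simp: left_def)
  qed
  then show ?thesis by (simp add: low_def)
qed

lemma partition:
  assumes "umbrella f" "v < n"
  shows "low f v + deg v + card (right f v) + 1 = n"
proof -
  have "{..<n} = insert v (left f v \<union> {u. A v u} \<union> right f v)"
    using umbrella_neq[OF assms(1,2)] assms(2) A_less2 A_sym by (auto simp: left_def right_def)
  then have "n = card (insert v (left f v \<union> {u. A v u} \<union> right f v))"
    by (metis card_lessThan)
  also have "\<dots> = Suc (card (left f v \<union> {u. A v u} \<union> right f v))"
    by (rule card_insert_disjoint) (auto simp: left_def right_def A_irrefl)
  also have "\<dots> = Suc (card (left f v) + card {u. A v u} + card (right f v))"
    by (subst card_Un_disjoint, simp, simp, use A_sym in \<open>force simp: left_def right_def\<close>,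
        subst card_Un_disjoint) (use A_sym in \<open>auto simp: left_def right_def\<close>)
  finally show ?thesis by (simp add: low_def deg_def)
qed

text \<open>Bounds the number of buckets and so keeps counting sort linear. By
  \<open>partition\<close>, even \<open>low f v + deg v\<close> is below \<open>n\<close>.\<close>

lemma key_le:
  assumes "umbrella f" "v < n"
  shows "key f v \<le> 2 * n"
  using partition[OF assms] by (simp add: key_def)

context
  fixes f :: "nat \<Rightarrow> 'b::linorder" and x y
  assumes f: "umbrella f" and x: "x < n" and y: "y < n" and xy: "f x < f y"
begin

lemma left_mono: "left f x \<subseteq> left f y"
proof
  fix u assume "u \<in> left f x"
  then show "u \<in> left f y"
    using umbrellaD(1)[OF f _ x, of u y] xy by (auto simp: left_def)
qed

lemma right_antimono: "right f y \<subseteq> right f x"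
proof
  fix u assume u: "u \<in> right f y"
  then have "\<not> A u x" using umbrellaD(2)[OF f _ y, of x u] xy A_sym by (auto simp: right_def)
  then show "u \<in> right f x" using u xy by (auto simp: right_def)
qed

text \<open>The first position grows with \<open>left\<close>; by \<open>partition\<close>, the last
  position \<open>low f v + deg v\<close> grows as \<open>right\<close> shrinks.\<close>

lemma key_mono: "key f x \<le> key f y"
  using card_mono[OF _ left_mono] card_mono[OF _ right_antimono] partition[OF f x] partition[OF f y]
  by (simp add: key_def low_def)

text \<open>Both end positions are monotone, so equal sums force both to be equal. Inclusions
  between sets of equal size then identify the \<open>left\<close> sets and the \<open>right\<close>
  sets, whose union is the complement of the closed neighbourhood. If \<open>x\<close> and
  \<open>y\<close> were not adjacent, \<open>x\<close> would be in \<open>left f y\<close> but not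
  in \<open>left f x\<close>.\<close>

lemma key_eq_twins_aux:
  assumes "key f x = key f y"
  shows "A x y" and "u \<noteq> x \<Longrightarrow> u \<noteq> y \<Longrightarrow> A x u = A y u"
proof -
  have "card (left f x) \<le> card (left f y)" "card (right f y) \<le> card (right f x)"
    by (auto intro!: card_mono left_mono right_antimono)
  then have "card (left f x) = card (left f y)" "card (right f y) = card (right f x)"
    using assms partition[OF f x] partition[OF f y] by (auto simp: key_def low_def)
  then have l: "left f x = left f y" and r: "right f x = right f y"
    using card_subset_eq[OF _ left_mono] card_subset_eq[OF _ right_antimono] by auto
  show "A x y" using l x xy by (auto simp: left_def)
  assume u: "u \<noteq> x" "u \<noteq> y"
  show "A x u = A y u"
  proof (cases "u < n")
    case True
    then have "A x u \<longleftrightarrow> u \<notin> left f x \<union> right f x" "A y u \<longleftrightarrow> u \<notin> left f y \<union> right f y"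
      using u umbrella_neq[OF f True] x y A_sym by (auto simp: left_def right_def)
    then show ?thesis using l r by simp
  qed (use A_less2 in blast)
qed

end

lemma key_eq_twins:
  assumes f: "umbrella f" and "x < n" "y < n" "x \<noteq> y" "key f x = key f y"
  shows "A x y" and "u \<noteq> x \<Longrightarrow> u \<noteq> y \<Longrightarrow> A x u = A y u"
  using umbrella_neq[OF f assms(2-4)] key_eq_twins_aux[OF f assms(2,3) _ assms(5)]
    key_eq_twins_aux[OF f assms(3,2) _ assms(5)[symmetric]] A_sym by blast+

text \<open>Ties occur only between twins, which can be exchanged freely, so every way of breaking
  them gives an umbrella order. Nonadjacent vertices have different keys and keep their order, so
  \<open>low\<close> is the same for \<open>g\<close> as for \<open>f\<close>.\<close>

lemma sort_by_key:
  assumes f: "umbrella f" and g: "inj_on g {..<n}"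
    and mono: "\<And>x y. x < n \<Longrightarrow> y < n \<Longrightarrow> g x < g y \<Longrightarrow> key f x \<le> key f y"
  shows "umbrella g" and "agree f g"
proof -
  have *: "A x y \<and> A y z" if "x < n" "y < n" "z < n" "g x < g y" "g y < g z" "A x z" for x y z
  proof -
    have ne: "x \<noteq> y" "y \<noteq> z" "x \<noteq> z" using that A_irrefl by auto
    have le: "key f x \<le> key f y" "key f y \<le> key f z" using mono that by blast+
    consider "key f x = key f y" | "key f y = key f z" | "key f x < key f y" "key f y < key f z"
      using le by linarith
    then show ?thesis
    proof cases
      case 1
      then show ?thesis using key_eq_twins[OF f that(1,2) ne(1)] that ne by auto
    next
      case 2
      then show ?thesis using key_eq_twins[OF f that(2,3) ne(2)] that(6) ne A_sym by blast
    next
      case 3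
      then have "\<not> f y < f x" "\<not> f z < f y"
        using key_mono[OF f] that(1-3) leD by blast+
      then have "f x < f y" "f y < f z"
        using umbrella_neq[OF f that(1,2) ne(1)] umbrella_neq[OF f that(2,3) ne(2)] by auto
      then show ?thesis using umbrellaD[OF f that(6,2)] by blast
    qed
  qed
  then show "umbrella g" using g unfolding umbrella_def by blast
  show "agree f g"
    unfolding agree_def
  proof (intro allI impI)
    fix x y assume xy: "x < n" "y < n" "f x < f y" "\<not> A x y"
    then have "x \<noteq> y" by auto
    then have "key f x \<noteq> key f y" using key_eq_twins(1)[OF f xy(1,2)] xy(4) by blast
    then have "key f x < key f y" using key_mono[OF f xy(1-3)] by simp
    then have "\<not> g y < g x" using mono[OF xy(2,1)] by auto
    then show "g x < g y" using g xy \<open>x \<noteq> y\<close> by (metis inj_onD lessThan_iff linorder_neqE)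
  qed
qed

lemma card_before:
  assumes "bij_betw g {..<n} {..<n}" "v < n"
  shows "card {u. u < n \<and> g u < g v} = g v"
proof -
  have "g ` {u. u < n \<and> g u < g v} = {..<g v}"
  proof
    show "{..<g v} \<subseteq> g ` {u. u < n \<and> g u < g v}"
    proof
      fix i assume i: "i \<in> {..<g v}"
      have "g v \<in> {..<n}" using assms by (auto simp: bij_betw_def)
      then have "i \<in> {..<n}" using i by simp
      then have "i \<in> g ` {..<n}" using assms(1) by (simp add: bij_betw_def)
      then show "i \<in> g ` {u. u < n \<and> g u < g v}" using i by auto
    qed
  qed auto
  moreover have "inj_on g {u. u < n \<and> g u < g v}"
    using assms(1) by (auto simp: bij_betw_def inj_on_def)
  ultimately show ?thesis by (metis card_image card_lessThan)
qed

text \<open>This needs only a bijective numbering, not an interval order, so it yields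
  \<open>low\<close> from a search order by counting the earlier neighbours of each vertex.\<close>

lemma low_eq:
  assumes "bij_betw g {..<n} {..<n}" "v < n"
  shows "low g v + card {u. A v u \<and> g u < g v} = g v"
proof -
  have "{u. u < n \<and> g u < g v} = left g v \<union> {u. A v u \<and> g u < g v}"
    using A_less2 A_sym by (auto simp: left_def)
  then have "g v = card (left g v \<union> {u. A v u \<and> g u < g v})" using card_before[OF assms] by simp
  also have "\<dots> = card (left g v) + card {u. A v u \<and> g u < g v}"
    by (rule card_Un_disjoint)
      (use A_sym in \<open>auto simp: left_def intro: finite_subset[OF _ finite_nbrs[of v]]\<close>)
  finally show ?thesis by (simp add: low_def)
qed

text \<open>By \<open>low_eq\<close>, \<open>low g x + deg x\<close> is \<open>g x\<close> plus the
  number of later neighbours, and in an umbrella order these occupy the positions directly after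
  \<open>g x\<close>. An edge between positions \<open>i\<close> and \<open>i + 2 * k\<close> is
  thus recognised by one comparison.\<close>

lemma A_iff_le:
  assumes g: "umbrella g" and bij: "bij_betw g {..<n} {..<n}"
    and x: "x < n" and y: "y < n" and xy: "g x < g y"
  shows "A x y \<longleftrightarrow> g y \<le> low g x + deg x"
proof -
  let ?r = "{u. A x u \<and> g x < g u}"
  have "{u. A x u} = {u. A x u \<and> g u < g x} \<union> ?r"
    using umbrella_neq[OF g x] A_irrefl A_less2 by blast
  then have "deg x = card ({u. A x u \<and> g u < g x} \<union> ?r)"
    unfolding deg_def by (rule arg_cong)
  also have "\<dots> = card {u. A x u \<and> g u < g x} + card ?r"
    by (rule card_Un_disjoint) (auto intro: finite_subset[OF _ finite_nbrs[of x]])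
  finally have eq: "low g x + deg x = g x + card ?r" using low_eq[OF bij x] by simp
  have inj: "inj_on g ?r"
    using bij A_less2 unfolding bij_betw_def by (auto simp: inj_on_def)
  have fin: "finite ?r" by (rule finite_subset[OF _ finite_nbrs[of x]]) auto
  show ?thesis
  proof
    assume A: "A x y"
    have "{g x<..g y} \<subseteq> g ` ?r"
    proof
      fix i assume i: "i \<in> {g x<..g y}"
      moreover have "g y < n" using bij y by (auto simp: bij_betw_def)
      ultimately have "i \<in> g ` {..<n}" using bij by (auto simp: bij_betw_def)
      then obtain u where u: "u < n" "i = g u" by auto
      have "A x u" using umbrellaD(1)[OF g A u(1)] i u A
        by (metis bij bij_betw_def greaterThanAtMost_iff inj_onD le_neq_implies_less lessThan_iff y)
      then show "i \<in> g ` ?r" using i u by auto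
    qed
    then have "card {g x<..g y} \<le> card (g ` ?r)" using fin by (intro card_mono) auto
    then show "g y \<le> low g x + deg x" using eq card_image[OF inj] by simp
  next
    assume le: "g y \<le> low g x + deg x"
    show "A x y"
    proof (rule ccontr)
      assume "\<not> A x y"
      have "g ` ?r \<subseteq> {g x<..<g y}"
      proof
        fix i assume "i \<in> g ` ?r"
        then obtain u where u: "A x u" "g x < g u" "i = g u" by auto
        have "u \<noteq> y" using u \<open>\<not> A x y\<close> by auto
        moreover have "\<not> g y < g u" using umbrellaD(1)[OF g u(1) y xy] \<open>\<not> A x y\<close> by blast
        ultimately show "i \<in> {g x<..<g y}"
          using umbrella_neq[OF g A_less2[OF u(1)] y] u by auto
      qed
      then have "card (g ` ?r) \<le> card {g x<..<g y}" by (intro card_mono) auto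
      then show False using eq le card_image[OF inj] xy by simp
    qed
  qed
qed

section \<open>Breadth-first search trees and the ends of a component\<close>

text \<open>A union of connected components. Closed sets take the place of paths and
  reachability.\<close>

definition closed :: "nat set \<Rightarrow> bool" where
  "closed X \<longleftrightarrow> (\<forall>x\<in>X. \<forall>y. A x y \<longrightarrow> y \<in> X)"

text \<open>Breadth-first search puts vertices \<open>q a\<close>, \dots, \<open>q (b - 1)\<close> into a queue; \<open>p v\<close> is the
  queue position of the parent of \<open>v\<close> in the search tree.\<close>

definition bfs_tree :: "(nat \<Rightarrow> nat) \<Rightarrow> (nat \<Rightarrow> nat) \<Rightarrow> nat \<Rightarrow> nat \<Rightarrow> bool" where
  "bfs_tree q p a b \<longleftrightarrow> a < b \<and> inj_on q {a..<b} \<and> (\<forall>i. a \<le> i \<and> i < b \<longrightarrow> q i < n) \<and>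
     (\<forall>i. a < i \<and> i < b \<longrightarrow> a \<le> p (q i) \<and> p (q i) < i \<and> A (q (p (q i))) (q i) \<and>
        (\<forall>j. a \<le> j \<and> j < p (q i) \<longrightarrow> \<not> A (q j) (q i))) \<and>
     (\<forall>i j. a < i \<and> i \<le> j \<and> j < b \<longrightarrow> p (q i) \<le> p (q j))"

text \<open>The condition says that \<open>w\<close> is, up to twins, the leftmost vertex of \<open>C\<close>.\<close>

definition left_end :: "(nat \<Rightarrow> 'b::linorder) \<Rightarrow> nat set \<Rightarrow> nat \<Rightarrow> bool" where
  "left_end f C w \<longleftrightarrow> (\<forall>x\<in>C. f x < f w \<longrightarrow> A x w \<and> (\<forall>y. A w y \<longrightarrow> y \<noteq> x \<longrightarrow> A x y))"

context
  fixes q p :: "nat \<Rightarrow> nat" and a b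
  assumes t: "bfs_tree q p a b"
begin

lemma bfs_ab: "a < b" and bfs_inj: "inj_on q {a..<b}"
  and bfs_less: "a \<le> i \<Longrightarrow> i < b \<Longrightarrow> q i < n"
  and bfs_parent: "a < i \<Longrightarrow> i < b \<Longrightarrow> a \<le> p (q i) \<and> p (q i) < i \<and> A (q (p (q i))) (q i)"
  and bfs_first: "a < i \<Longrightarrow> i < b \<Longrightarrow> a \<le> j \<Longrightarrow> A (q j) (q i) \<Longrightarrow> p (q i) \<le> j"
  and bfs_mono: "a < i \<Longrightarrow> i \<le> j \<Longrightarrow> j < b \<Longrightarrow> p (q i) \<le> p (q j)"
  using t unfolding bfs_tree_def by (blast, blast, blast, blast, metis not_le, blast)

lemma bfs_neq: "a \<le> i \<Longrightarrow> i < b \<Longrightarrow> a \<le> j \<Longrightarrow> j < b \<Longrightarrow> i \<noteq> j \<Longrightarrow> q i \<noteq> q j"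
  using bfs_inj by (auto simp: inj_on_def)

lemma bfs_subset_closed:
  assumes "closed X" "q a \<in> X"
  shows "q ` {a..<b} \<subseteq> X"
proof -
  have "a \<le> i \<Longrightarrow> i < b \<Longrightarrow> q i \<in> X" for i
  proof (induction i rule: less_induct)
    case (less i)
    show ?case
    proof (cases "i = a")
      case False
      then have "a < i" using less.prems by simp
      with bfs_parent[OF this less.prems(2)] less show ?thesis
        using assms(1) unfolding closed_def by (metis order.strict_trans)
    qed (use assms in simp)
  qed
  then show ?thesis by auto
qed

text \<open>With \<open>bfs_subset_closed\<close>, a closed set contains all of a search tree or
  nothing of it.\<close>

lemma bfs_source_in_closed:
  assumes "closed X" "q i \<in> X" "a \<le> i" "i < b"
  shows "q a \<in> X"
  using assms(2-)
proof (induction i rule: less_induct)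
  case (less i)
  show ?case
  proof (cases "i = a")
    case False
    then have "a < i" using less.prems by simp
    with bfs_parent[OF this less.prems(3)] less show ?thesis
      using assms(1) A_sym unfolding closed_def by (metis order.strict_trans)
  qed (use less.prems in simp)
qed

text \<open>Suppose \<open>j < i\<close>, with \<open>j\<close> minimal, and let \<open>P\<close> be
  the parent position of \<open>q j\<close>. The umbrella property and minimality put
  \<open>q P\<close> to the right of \<open>q i\<close> and make the two adjacent; as parents are
  monotone, \<open>P\<close> is also the parent of \<open>q i\<close>. If \<open>q P\<close> is the
  source, being a left end makes \<open>q i\<close> adjacent to \<open>q j\<close>. Otherwise the
  parent \<open>Q\<close> of \<open>q P\<close> holds a nonneighbour of \<open>q i\<close> to its
  right, and minimality gives \<open>i < Q\<close>, against \<open>Q < P < j < i\<close>.\<close>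

lemma bfs_order:
  assumes f: "umbrella f" and l: "left_end f (q ` {a..<b}) (q a)"
    and "a \<le> i" "i < b" "a \<le> j" "j < b" "f (q i) < f (q j)" "\<not> A (q i) (q j)"
  shows "i < j"
  using assms(3-)
proof (induction j rule: less_induct)
  case (less j)
  show ?case
  proof (rule ccontr)
    assume "\<not> i < j"
    have "i \<noteq> j" using less.prems by auto
    then have ji: "j < i" using \<open>\<not> i < j\<close> by simp
    have lD: "A (q i) (q a) \<and> (\<forall>y. A (q a) y \<longrightarrow> y \<noteq> q i \<longrightarrow> A (q i) y)" if "f (q i) < f (q a)"
      using l that less.prems unfolding left_end_def by auto
    have "j \<noteq> a" using lD less.prems by auto
    then have aj: "a < j" using less.prems by simp
    note pj = bfs_parent[OF aj less.prems(4)]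
    let ?P = "p (q j)"
    have n: "q i < n" "q j < n" using bfs_less less.prems by auto
    have "\<not> f (q ?P) < f (q i)"
      using umbrellaD(2)[OF f _ n(1), of "q ?P" "q j"] pj less.prems by blast
    then have 1: "f (q i) < f (q ?P)"
      using umbrella_neq[OF f n(1) bfs_less[of ?P]] bfs_neq[of i ?P] pj ji less.prems by force
    have 2: "A (q i) (q ?P)"
    proof (rule ccontr)
      assume "\<not> A (q i) (q ?P)"
      then have "i < ?P" using less.IH[of ?P] 1 pj less.prems by auto
      then show False using ji pj by simp
    qed
    have ai: "a < i" using aj ji by simp
    have "p (q i) \<le> ?P" using bfs_first[OF ai less.prems(2)] 2 pj A_sym by blast
    moreover have "?P \<le> p (q i)" using bfs_mono[OF aj, of i] ji less.prems by simp
    ultimately have pi: "p (q i) = ?P" by simp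
    show False
    proof (cases "?P = a")
      case True
      then have "A (q i) (q j)" using lD 1 pj bfs_neq[of i j] ji less.prems by auto
      then show False using less.prems by blast
    next
      case False
      let ?Q = "p (q ?P)"
      have Pb: "a < ?P" "?P < b" using False pj less.prems by auto
      note pP = bfs_parent[OF Pb]
      have nA: "\<not> A (q ?Q) (q i)"
        using bfs_first[OF ai less.prems(2), of ?Q] pP pi by auto
      then have "\<not> f (q ?Q) < f (q i)"
        using umbrellaD(1)[OF f _ n(1), of "q ?Q" "q ?P"] pP 1 by blast
      then have "f (q i) < f (q ?Q)"
        using umbrella_neq[OF f n(1) bfs_less[of ?Q]] bfs_neq[of i ?Q] pP pj ji less.prems by force
      then have "i < ?Q" using less.IH[of ?Q] nA pP pj A_sym less.prems by auto
      then show False using pP pj ji by simp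
    qed
  qed
qed

text \<open>The path in the search tree from \<open>q a\<close> to \<open>q i\<close> cannot jump over \<open>q m\<close> without meeting a
  neighbour of \<open>q m\<close>.\<close>

lemma bfs_crossing:
  assumes f: "umbrella f" and m: "m < b" and "a \<le> i" "i < m"
    "f (q a) < f (q m) \<and> f (q m) < f (q i) \<or> f (q i) < f (q m) \<and> f (q m) < f (q a)"
  shows "\<exists>j. a \<le> j \<and> j < i \<and> A (q j) (q m)"
  using assms(3-)
proof (induction i rule: less_induct)
  case (less i)
  then have "i \<noteq> a" by auto
  then have ai: "a < i" using less.prems by simp
  note pi = bfs_parent[OF ai order.strict_trans[OF less.prems(2) m]]
  let ?P = "p (q i)"
  have n: "q m < n" "q ?P < n" using bfs_less pi less.prems m by auto
  have "q m \<noteq> q ?P" using bfs_neq[of m ?P] pi less.prems m by auto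
  then consider "f (q m) < f (q ?P)" | "f (q ?P) < f (q m)"
    using umbrella_neq[OF f n] by blast
  note side = this
  show ?case
  proof (cases "A (q ?P) (q m)")
    case False
    have "\<not> A (q m) (q ?P)" using False A_sym by blast
    then have "f (q a) < f (q m) \<and> f (q m) < f (q ?P) \<or> f (q ?P) < f (q m) \<and> f (q m) < f (q a)"
      using side umbrellaD[OF f _ n(1), of "q ?P" "q i"] umbrellaD[OF f _ n(1), of "q i" "q ?P"]
        pi less.prems(3) False A_sym by metis
    then show ?thesis using less.IH[of ?P] pi less.prems by force
  qed (use pi in blast)
qed

text \<open>No position before the parent \<open>P\<close> of \<open>w\<close> holds a neighbour of
  \<open>w\<close>, so by \<open>bfs_crossing\<close> the queue up to \<open>P\<close> lies to the
  right of \<open>w\<close>. A vertex \<open>x\<close> to the left of \<open>w\<close> has its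
  parent among these; the umbrella property makes \<open>x\<close> adjacent to \<open>w\<close> and
  forces that parent to be \<open>P\<close>. So \<open>x\<close> took part in the choice of least
  degree, and its closed neighbourhood, contained in that of \<open>w\<close>, must equal
  it.\<close>

lemma bfs_left_end:
  assumes f: "umbrella f" and cl: "closed (q ` {a..<b})" and m: "a < m" "m < b"
    and last: "p (q m) = p (q (b - 1))"
    and mindeg: "\<And>i. a < i \<Longrightarrow> i < b \<Longrightarrow> p (q i) = p (q (b - 1)) \<Longrightarrow> deg (q m) \<le> deg (q i)"
    and side: "f (q m) < f (q (p (q m)))"
  shows "left_end f (q ` {a..<b}) (q m)"
  unfolding left_end_def
proof (intro ballI impI)
  let ?w = "q m" and ?P = "p (q m)"
  fix x assume "x \<in> q ` {a..<b}" and xw: "f x < f ?w"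
  then obtain i where i: "a \<le> i" "i < b" "x = q i" by auto
  note pm = bfs_parent[OF m]
  have w: "?w < n" using bfs_less m by auto
  have noadj: "\<not> A (q j) ?w" if "a \<le> j" "j < ?P" for j
    using bfs_first[OF m, of j] that by auto
  have same: "\<not> (f (q a) < f ?w \<and> f ?w < f (q j) \<or> f (q j) < f ?w \<and> f ?w < f (q a))"
    if "a \<le> j" "j \<le> ?P" for j
    using bfs_crossing[OF f m(2) that(1)] noadj that pm by force
  have neq: "f ?w < f (q j) \<or> f (q j) < f ?w" if "a \<le> j" "j \<le> ?P" for j
    using umbrella_neq[OF f w bfs_less[of j]] bfs_neq[of m j] that pm m by force
  have right: "f ?w < f (q j)" if "a \<le> j" "j \<le> ?P" for j
    using same[of ?P] same[of j] neq[of a] neq[of j] side that pm by auto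
  have "i \<noteq> a" using right[of a] xw i pm by (auto dest: less_asym)
  then have ai: "a < i" using i by simp
  note pi = bfs_parent[OF ai i(2)]
  let ?T = "p (q i)"
  have "?T \<le> ?P" unfolding last using bfs_mono[OF ai, of "b - 1"] i by simp
  moreover have "\<not> ?T < ?P"
  proof
    assume T: "?T < ?P"
    have "A (q i) (q ?T)" using pi A_sym by blast
    then have "A ?w (q ?T)"
      using umbrellaD(2)[OF f _ w, of x "q ?T"] right[of ?T] xw i pi T by simp
    then show False using noadj[of ?T] T pi A_sym by blast
  qed
  ultimately have T: "?T = ?P" by simp
  then have le: "deg ?w \<le> deg x" using mindeg[OF ai i(2)] last i by simp
  have adj: "A x ?w" if x: "x \<in> q ` {a..<b}" and xw: "f x < f ?w" for x
  proof -
    obtain i where i: "a \<le> i" "i < b" "x = q i" using x by auto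
    have "i \<noteq> a" using right[of a] xw i pm by (auto dest: less_asym)
    then have ai: "a < i" using i by simp
    note pi = bfs_parent[OF ai i(2)]
    let ?T = "p (q i)"
    have "?T \<le> ?P" unfolding last using bfs_mono[OF ai, of "b - 1"] i by simp
    moreover have "A (q i) (q ?T)" using pi A_sym by blast
    ultimately show ?thesis
      using umbrellaD(1)[OF f _ w, of x "q ?T"] right[of ?T] xw i pi by simp
  qed
  have x: "x \<in> q ` {a..<b}" using i by auto
  \<comment> \<open>A neighbour of \<open>x\<close> to the left of \<open>w\<close> is adjacent to
    \<open>w\<close> by \<open>adj\<close>; for one to the right, the edge from \<open>x\<close>
    passes over \<open>w\<close>.\<close>
  have "insert x {u. A x u} \<subseteq> insert ?w {u. A ?w u}"
  proof
    fix u assume "u \<in> insert x {u. A x u}"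
    then consider "u = x" | "u = ?w" | "A x u" "u \<noteq> ?w" by blast
    then show "u \<in> insert ?w {u. A ?w u}"
    proof cases
      case 3
      then have u: "u \<in> q ` {a..<b}" using cl x unfolding closed_def by blast
      have "f u < f ?w \<or> f ?w < f u" using umbrella_neq[OF f A_less2[OF 3(1)] w 3(2)] .
      then show ?thesis
        using adj[OF u] umbrellaD(2)[OF f 3(1) w xw] A_sym by blast
    qed (use adj[OF x xw] A_sym in auto)
  qed
  moreover have "card (insert ?w {u. A ?w u}) \<le> card (insert x {u. A x u})"
    using le by (simp add: A_irrefl deg_def)
  ultimately have "insert x {u. A x u} = insert ?w {u. A ?w u}"
    by (intro card_seteq) auto
  then show "A x ?w \<and> (\<forall>y. A ?w y \<longrightarrow> y \<noteq> x \<longrightarrow> A x y)"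
    using adj[OF x xw] by blast
qed

end

text \<open>Negation reverses an interval order. This is why orders of unknown direction take
  integer values.\<close>

lemma umbrella_uminus:
  fixes f :: "nat \<Rightarrow> int"
  assumes "umbrella f"
  shows "umbrella (\<lambda>x. - f x)"
  using assms A_sym unfolding umbrella_def by (simp add: inj_on_def)

text \<open>The children of the last parent contain an end of the component, which has the least degree
  among those on its side of that parent.\<close>

definition end_choice :: "(nat \<Rightarrow> nat) \<Rightarrow> (nat \<Rightarrow> nat) \<Rightarrow> nat \<Rightarrow> nat \<Rightarrow> nat \<Rightarrow> bool" where
  "end_choice q p a b w \<longleftrightarrow> w = q a \<and> b = Suc a \<or>
  (\<exists>m. w = q m \<and> a < m \<and> m < b \<and> p (q m) = p (q (b - 1)) \<and>
      (\<forall>i. a < i \<and> i < b \<and> p (q i) = p (q (b - 1)) \<longrightarrow> deg (q m) \<le> deg (q i)))"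

text \<open>The chosen vertex may lie to the right of its parent and be a right end; then the
  reversed order serves as \<open>g\<close>.\<close>

lemma bfs_end:
  fixes f :: "nat \<Rightarrow> int"
  assumes t: "bfs_tree q p a b" and f: "umbrella f" and cl: "closed (q ` {a..<b})"
    and w: "end_choice q p a b w"
  shows "\<exists>g::nat \<Rightarrow> int. umbrella g \<and> left_end g (q ` {a..<b}) w"
  using w unfolding end_choice_def
proof
  assume "w = q a \<and> b = Suc a"
  then have "left_end f (q ` {a..<b}) w" by (simp add: left_end_def)
  then show ?thesis using f by blast
next
  assume "\<exists>m. w = q m \<and> a < m \<and> m < b \<and> p (q m) = p (q (b - 1)) \<and>
      (\<forall>i. a < i \<and> i < b \<and> p (q i) = p (q (b - 1)) \<longrightarrow> deg (q m) \<le> deg (q i))"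
  then obtain m where m: "w = q m" "a < m" "m < b" "p (q m) = p (q (b - 1))"
    "\<And>i. a < i \<Longrightarrow> i < b \<Longrightarrow> p (q i) = p (q (b - 1)) \<Longrightarrow> deg (q m) \<le> deg (q i)" by blast
  note pm = bfs_parent[OF t m(2,3)]
  have "q m \<noteq> q (p (q m))" using A_irrefl pm by metis
  then have "f (q m) < f (q (p (q m))) \<or> f (q (p (q m))) < f (q m)"
    using umbrella_neq[OF f A_less2 A_less] pm by blast
  then show ?thesis
    using bfs_left_end[OF t f cl m(2-5)] bfs_left_end[OF t umbrella_uminus[OF f] cl m(2-5)]
      f umbrella_uminus[OF f] m(1) by auto
qed

text \<open>Each search tree is connected and fills a closed set, and the two meet. Equal size then
  makes the second search overwrite exactly the queue segment of the first.\<close>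

lemma bfs_same_component:
  assumes t: "bfs_tree q p a b" and cl: "closed (q ` {a..<b})"
    and t': "bfs_tree q' p' a b'" and cl': "closed (q' ` {a..<b'})"
    and src: "q' a \<in> q ` {a..<b}"
  shows "q' ` {a..<b'} = q ` {a..<b}" and "b' = b"
proof -
  obtain i where i: "a \<le> i" "i < b" "q i = q' a" using src by auto
  have "q' a \<in> q' ` {a..<b'}" using bfs_ab[OF t'] by auto
  then have "q a \<in> q' ` {a..<b'}" using bfs_source_in_closed[OF t cl' _ i(1,2)] i(3) by simp
  then show eq: "q' ` {a..<b'} = q ` {a..<b}"
    using bfs_subset_closed[OF t cl'] bfs_subset_closed[OF t' cl src] by blast
  then have "b' - a = b - a"
    using card_image[OF bfs_inj[OF t]] card_image[OF bfs_inj[OF t']] by simp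
  then show "b' = b" using bfs_ab[OF t] bfs_ab[OF t'] by simp
qed

section \<open>Queues of finished components and the choice of their directions\<close>

definition queue_ok :: "(nat \<Rightarrow> nat) \<Rightarrow> nat \<Rightarrow> bool" where
  "queue_ok q h \<longleftrightarrow> inj_on q {..<h} \<and> (\<forall>i<h. q i < n) \<and> closed (q ` {..<h}) \<and>
     (\<exists>f::nat \<Rightarrow> int. umbrella f \<and> (\<forall>i<h. \<forall>v<n. v \<notin> q ` {..<h} \<longrightarrow> f (q i) < f v) \<and>
        (\<forall>i<h. \<forall>j<h. f (q i) < f (q j) \<longrightarrow> \<not> A (q i) (q j) \<longrightarrow> i < j))"

text \<open>The new order consists of three blocks: \<open>M\<close> ordered by \<open>f\<close>,
  \<open>C\<close> ordered by \<open>g\<close>, and the rest ordered by \<open>f\<close>. No edge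
  joins two blocks, so the umbrella condition concerns only vertices of one block.\<close>

lemma reorient:
  fixes f g :: "nat \<Rightarrow> int"
  assumes f: "umbrella f" and g: "umbrella g" and M: "closed M" and C: "closed C"
    and disj: "M \<inter> C = {}"
  obtains f' :: "nat \<Rightarrow> int" where "umbrella f'"
    and "\<And>x y. x \<in> M \<Longrightarrow> y \<in> M \<Longrightarrow> f' x < f' y \<longleftrightarrow> f x < f y"
    and "\<And>x y. x \<in> C \<Longrightarrow> y \<in> C \<Longrightarrow> f' x < f' y \<longleftrightarrow> g x < g y"
    and "\<And>x y. x < n \<Longrightarrow> y < n \<Longrightarrow> x \<in> M \<Longrightarrow> y \<notin> M \<Longrightarrow> f' x < f' y"
    and "\<And>x y. x < n \<Longrightarrow> y < n \<Longrightarrow> x \<in> C \<Longrightarrow> y \<notin> M \<Longrightarrow> y \<notin> C \<Longrightarrow> f' x < f' y"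
proof -
  define B where "B = (\<Sum>x<n. \<bar>f x\<bar> + \<bar>g x\<bar>) + 1"
  have B: "\<bar>f x\<bar> < B" "\<bar>g x\<bar> < B" if "x < n" for x
  proof -
    have "\<bar>f x\<bar> + \<bar>g x\<bar> \<le> (\<Sum>x<n. \<bar>f x\<bar> + \<bar>g x\<bar>)"
      by (rule member_le_sum[of x _ "\<lambda>x. \<bar>f x\<bar> + \<bar>g x\<bar>"]) (use that in auto)
    then show "\<bar>f x\<bar> < B" "\<bar>g x\<bar> < B" by (auto simp: B_def)
  qed
  \<comment> \<open>On vertices both orders stay strictly between \<open>-B\<close> and
    \<open>B\<close>, so shifts by 0, \<open>2 * B\<close> and \<open>4 * B\<close> keep the blocks
    apart.\<close>
  define f' where "f' x = (if x \<in> M then f x else if x \<in> C then 2 * B + g x else 4 * B + f x)" for x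
  have less: "f' x < f' y \<longleftrightarrow> (if x \<in> M \<longleftrightarrow> y \<in> M then if x \<in> C \<longleftrightarrow> y \<in> C then
      if x \<in> C then g x < g y else f x < f y else x \<in> C else x \<in> M)" if "x < n" "y < n" for x y
    using B[OF that(1)] B[OF that(2)] disj by (auto simp: f'_def abs_less_iff)
  have cls: "x \<in> M \<longleftrightarrow> z \<in> M" "x \<in> C \<longleftrightarrow> z \<in> C" if "A x z" for x z
    using that M C A_sym unfolding closed_def by blast+
  have "A x y \<and> A y z" if "x < n" "y < n" "z < n" "f' x < f' y" "f' y < f' z" "A x z" for x y z
    using that(4,5) cls[OF that(6)] umbrellaD[OF f that(6,2)] umbrellaD[OF g that(6,2)]
    unfolding less[OF that(1,2)] less[OF that(2,3)] by (auto split: if_splits)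
  moreover have "inj_on f' {..<n}"
  proof (rule inj_onI, rule ccontr)
    fix x y assume xy: "x \<in> {..<n}" "y \<in> {..<n}" "f' x = f' y" "x \<noteq> y"
    then have "\<not> f' x < f' y" "\<not> f' y < f' x" by auto
    then show False
      using xy less[of x y] less[of y x] umbrella_neq[OF f, of x y] umbrella_neq[OF g, of x y] disj
      by (auto split: if_splits)
  qed
  ultimately have "umbrella f'" unfolding umbrella_def by blast
  moreover have "f' x < f' y \<longleftrightarrow> f x < f y" if "x \<in> M" "y \<in> M" for x y
    using that by (simp add: f'_def)
  moreover have "f' x < f' y \<longleftrightarrow> g x < g y" if "x \<in> C" "y \<in> C" for x y
  proof -
    have "x \<notin> M" "y \<notin> M" using that disj by auto
    then show ?thesis using that by (simp add: f'_def)
  qed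
  moreover have "f' x < f' y" if "x < n" "y < n" "x \<in> M" "y \<notin> M" for x y
    using less[OF that(1,2)] that disj by auto
  moreover have "f' x < f' y" if "x < n" "y < n" "x \<in> C" "y \<notin> M" "y \<notin> C" for x y
    using less[OF that(1,2)] that disj by auto
  ultimately show ?thesis by (rule that)
qed

text \<open>The first search only serves to choose \<open>w\<close>. An order with \<open>w\<close>
  as left end of the component exists by \<open>bfs_end\<close>, \<open>reorient\<close> splices it
  in behind the finished vertices, and by \<open>bfs_order\<close> the second search respects it on
  nonadjacent pairs.\<close>

lemma queue_ok_step:
  assumes q: "queue_ok q a" and same: "\<forall>i<a. q1 i = q i" "\<forall>i<a. q2 i = q i"
    and t1: "bfs_tree q1 p1 a b1" and cl1: "closed (q1 ` {a..<b1})"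
    and w: "end_choice q1 p1 a b1 w"
    and t2: "bfs_tree q2 p2 a b2" and cl2: "closed (q2 ` {a..<b2})" and w2: "q2 a = w"
    and disj: "q ` {..<a} \<inter> q2 ` {a..<b2} = {}"
  shows "queue_ok q2 b2" and "b2 = b1" and "q2 ` {a..<b2} = q1 ` {a..<b1}"
proof -
  have "w \<in> q1 ` {a..<b1}" using w bfs_ab[OF t1] by (auto simp: end_choice_def)
  note eq = bfs_same_component[OF t1 cl1 t2 cl2, unfolded w2, OF this]
  show "b2 = b1" "q2 ` {a..<b2} = q1 ` {a..<b1}" by (rule eq)+
  let ?M = "q2 ` {..<a}" and ?C = "q2 ` {a..<b2}"
  have M: "?M = q ` {..<a}" using same(2) by (intro image_cong) auto
  have ab: "a < b2" using bfs_ab[OF t2] .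
  have all: "q2 ` {..<b2} = ?M \<union> ?C"
    using ab by (simp add: ivl_disj_un_one(2) flip: image_Un)
  from q obtain f :: "nat \<Rightarrow> int" where f: "umbrella f"
      "\<And>i j. i < a \<Longrightarrow> j < a \<Longrightarrow> f (q i) < f (q j) \<Longrightarrow> \<not> A (q i) (q j) \<Longrightarrow> i < j"
    unfolding queue_ok_def by blast
  obtain g :: "nat \<Rightarrow> int" where g: "umbrella g" "left_end g ?C w"
    using bfs_end[OF t1 f(1) cl1 w] eq by auto
  have clM: "closed ?M" using q unfolding M queue_ok_def by blast
  have disj': "?M \<inter> ?C = {}" using disj M by simp
  obtain f' :: "nat \<Rightarrow> int" where f': "umbrella f'"
    "\<And>x y. x \<in> ?M \<Longrightarrow> y \<in> ?M \<Longrightarrow> f' x < f' y \<longleftrightarrow> f x < f y"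
    "\<And>x y. x \<in> ?C \<Longrightarrow> y \<in> ?C \<Longrightarrow> f' x < f' y \<longleftrightarrow> g x < g y"
    "\<And>x y. x < n \<Longrightarrow> y < n \<Longrightarrow> x \<in> ?M \<Longrightarrow> y \<notin> ?M \<Longrightarrow> f' x < f' y"
    "\<And>x y. x < n \<Longrightarrow> y < n \<Longrightarrow> x \<in> ?C \<Longrightarrow> y \<notin> ?M \<Longrightarrow> y \<notin> ?C \<Longrightarrow> f' x < f' y"
    by (rule reorient[OF f(1) g(1) clM cl2 disj']) (rule that)
  have n: "q2 i < n" if "i < b2" for i
    using that q same(2) bfs_less[OF t2, of i] unfolding queue_ok_def by (cases "i < a") auto
  have inM: "q2 i \<in> ?M" if "i < a" for i using that by auto
  have inC: "q2 i \<in> ?C" "q2 i \<notin> ?M" if "\<not> i < a" "i < b2" for i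
  proof -
    show "q2 i \<in> ?C" using that by auto
    then show "q2 i \<notin> ?M" using disj M by auto
  qed
  show "queue_ok q2 b2"
    unfolding queue_ok_def
  proof (intro conjI exI[of _ f'] allI impI)
    show "inj_on q2 {..<b2}"
    proof (rule inj_onI)
      fix i j assume ij: "i \<in> {..<b2}" "j \<in> {..<b2}" "q2 i = q2 j"
      have "(i < a) = (j < a)" using ij inM[of i] inM[of j] inC(2)[of i] inC(2)[of j] by auto
      moreover have "inj_on q {..<a}" using q unfolding queue_ok_def by blast
      ultimately show "i = j" using ij same(2) bfs_inj[OF t2] by (cases "i < a") (auto simp: inj_on_def)
    qed
    show "closed (q2 ` {..<b2})" unfolding all using clM cl2 by (auto simp: closed_def)
    fix i assume i: "i < b2"
    show "q2 i < n" by (rule n[OF i])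
    {
      fix v assume v: "v < n" "v \<notin> q2 ` {..<b2}"
      then show "f' (q2 i) < f' v"
        using f'(4)[OF n[OF i] v(1)] f'(5)[OF n[OF i] v(1)] inM[of i] inC(1)[of i] i
        unfolding all by blast
    next
      fix j assume j: "j < b2" and ij: "f' (q2 i) < f' (q2 j)" "\<not> A (q2 i) (q2 j)"
      consider "i < a" "j < a" | "i < a" "\<not> j < a" | "\<not> i < a" "j < a" | "\<not> i < a" "\<not> j < a" by blast
      then show "i < j"
      proof cases
        case 1
        then show ?thesis using f'(2)[OF inM inM, of i j] f(2)[of i j] ij same(2) by simp
      next
        case 3
        then have "f' (q2 j) < f' (q2 i)" using f'(4)[OF n[OF j] n[OF i]] inM[of j] inC(2)[of i] i by blast
        then show ?thesis using ij by simp
      next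
        case 4
        then have "g (q2 i) < g (q2 j)" using f'(3)[OF inC(1) inC(1)] i j ij by blast
        moreover have "left_end g ?C (q2 a)" using g(2) w2 by simp
        ultimately show ?thesis using bfs_order[OF t2 g(1), of i j] 4 i j ij by simp
      qed simp
    }
  qed (rule f'(1))
qed

lemma queue_ok_0:
  assumes "umbrella (f :: nat \<Rightarrow> int)"
  shows "queue_ok q 0"
  using assms unfolding queue_ok_def by (auto simp: closed_def)

lemma queue_ok_agree:
  assumes q: "queue_ok q n" and pos: "\<And>i. i < n \<Longrightarrow> pos (q i) = i"
  shows "bij_betw pos {..<n} {..<n}" and "\<exists>f::nat \<Rightarrow> int. umbrella f \<and> agree f pos"
proof -
  have inj: "inj_on q {..<n}" and sub: "q ` {..<n} \<subseteq> {..<n}" using q by (auto simp: queue_ok_def)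
  have surj: "q ` {..<n} = {..<n}"
    by (rule card_subset_eq[OF _ sub]) (simp_all add: card_image[OF inj])
  show "bij_betw pos {..<n} {..<n}"
  proof (rule bij_betw_byWitness[of _ q])
    have inv: "q (pos v) = v \<and> pos v < n" if v: "v < n" for v
    proof -
      from v obtain i where "i < n" "v = q i" using surj by (metis imageE lessThan_iff)
      then show ?thesis using pos by simp
    qed
    then show "\<forall>v\<in>{..<n}. q (pos v) = v" "pos ` {..<n} \<subseteq> {..<n}" by auto
  qed (use pos sub in auto)
  from q obtain f :: "nat \<Rightarrow> int" where f: "umbrella f"
      "\<forall>i<n. \<forall>j<n. f (q i) < f (q j) \<longrightarrow> \<not> A (q i) (q j) \<longrightarrow> i < j"
    unfolding queue_ok_def by (elim conjE exE)
  have "agree f pos"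
    unfolding agree_def
  proof (intro allI impI)
    fix x y assume xy: "x < n" "y < n" "f x < f y" "\<not> A x y"
    then obtain i j where "i < n" "j < n" "x = q i" "y = q j"
      using surj by (metis imageE lessThan_iff)
    then show "pos x < pos y" using f(2)[rule_format, of i j] xy pos by simp
  qed
  then show "\<exists>f::nat \<Rightarrow> int. umbrella f \<and> agree f pos" using f(1) by blast
qed

end

section \<open>Programs with costs\<close>

lemma store_apply: "store s x i m y = (if y = x then (s x)(i := m) else s y)"
  by (simp add: store_def)

text \<open>Total correctness, with the exact cost passed to the postcondition. Since execution is
  deterministic, the run that exists is the only one, which lets the rules for loop-free commands be
  equivalences.\<close>

definition wp :: "com \<Rightarrow> (nat \<Rightarrow> state \<Rightarrow> bool) \<Rightarrow> state \<Rightarrow> bool" where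
  "wp p Q s \<longleftrightarrow> (\<exists>t s'. exec p s t s' \<and> Q t s')"

lemma wp_mono: "wp p Q s \<Longrightarrow> (\<And>t s'. Q t s' \<Longrightarrow> Q' t s') \<Longrightarrow> wp p Q' s"
  unfolding wp_def by blast

lemma wp_exec: "exec p s t s' \<Longrightarrow> wp p Q s \<longleftrightarrow> Q t s'"
  unfolding wp_def using exec_deterministic by blast

lemma wp_Skip [simp]: "wp Skip Q s \<longleftrightarrow> Q 1 s"
  by (rule wp_exec[OF exec.Skip])

lemma wp_Store [simp]:
  "wp (Store x a b) Q s \<longleftrightarrow> Q (1 + acost a + acost b) (store s x (aval a s) (aval b s))"
  by (rule wp_exec[OF exec.Store])

lemma wp_Seq [simp]: "wp (Seq p q) Q s \<longleftrightarrow> wp p (\<lambda>t1 s1. wp q (\<lambda>t2 s2. Q (t1 + t2) s2) s1) s"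
  unfolding wp_def by (blast intro: exec.Seq elim: exec_SeqE)

lemma wp_If [simp]:
  "wp (If b p q) Q s \<longleftrightarrow>
     (if bval b s then wp p (\<lambda>t. Q (bcost b + t)) s else wp q (\<lambda>t. Q (bcost b + t)) s)"
  unfolding wp_def by (auto intro: exec.IfTrue exec.IfFalse elim!: exec_IfE)

lemma wp_While_unfold:
  assumes "if bval b s then wp p (\<lambda>t1 s1. wp (While b p) (\<lambda>t2. Q (bcost b + t1 + t2)) s1) s
    else Q (bcost b) s"
  shows "wp (While b p) Q s"
  using assms unfolding wp_def
  by (cases "bval b s") (auto intro: exec.WhileTrue exec.WhileFalse)

lemma bcost_pos: "0 < bcost b"
  by (cases b) auto

text \<open>The potential pays for every test that succeeds and for the bodies. As tests have
  positive cost, it strictly decreases, so the cost bound also proves termination. The additional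
  \<open>bcost b\<close> is the final, failing test.\<close>

lemma wp_While:
  assumes "I s"
    and body: "\<And>s. I s \<Longrightarrow> bval b s \<Longrightarrow> wp p (\<lambda>t s'. I s' \<and> bcost b + t + \<Phi> s' \<le> \<Phi> s) s"
    and "\<And>t s'. I s' \<Longrightarrow> \<not> bval b s' \<Longrightarrow> t + \<Phi> s' \<le> \<Phi> s + bcost b \<Longrightarrow> Q t s'"
  shows "wp (While b p) Q s"
  using assms(1,3)
proof (induction "\<Phi> s" arbitrary: s Q rule: less_induct)
  case less
  show ?case
  proof (cases "bval b s")
    case True
    have "wp p (\<lambda>t1 s1. wp (While b p) (\<lambda>t2. Q (bcost b + t1 + t2)) s1) s"
    proof (rule wp_mono[OF body[OF less.prems(1) True]])
      fix t s'
      assume a: "I s' \<and> bcost b + t + \<Phi> s' \<le> \<Phi> s"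
      show "wp (While b p) (\<lambda>t2. Q (bcost b + t + t2)) s'"
      proof (rule less.hyps)
        show "\<Phi> s' < \<Phi> s" using a bcost_pos[of b] by linarith
        fix t2 s2 assume "I s2" "\<not> bval b s2" "t2 + \<Phi> s2 \<le> \<Phi> s' + bcost b"
        then show "Q (bcost b + t + t2) s2" using a by (intro less.prems(2)) auto
      qed (use a in simp)
    qed
    then show ?thesis using True by (intro wp_While_unfold) simp
  next
    case False
    then show ?thesis using less.prems by (intro wp_While_unfold) simp
  qed
qed

fun writes :: "com \<Rightarrow> vname set" where
  "writes Skip = {}"
| "writes (Store x a b) = {x}"
| "writes (Seq p q) = writes p \<union> writes q"
| "writes (If b p q) = writes p \<union> writes q"
| "writes (While b p) = writes p"

lemma exec_writes: "exec p s t s' \<Longrightarrow> x \<notin> writes p \<Longrightarrow> s' x = s x"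
  by (induction rule: exec.induct) (auto simp: store_apply)

lemma wp_frame:
  assumes "wp p Q s" "\<And>t s'. Q t s' \<Longrightarrow> (\<And>x. x \<notin> writes p \<Longrightarrow> s' x = s x) \<Longrightarrow> Q' t s'"
  shows "wp p Q' s"
  using assms exec_writes unfolding wp_def by metis

abbreviation Var :: "vname \<Rightarrow> aexp" where
  "Var x \<equiv> Read x (N 0)"

abbreviation Assign :: "vname \<Rightarrow> aexp \<Rightarrow> com" where
  "Assign x \<equiv> Store x (N 0)"

text \<open>The bound \<open>b\<close> is evaluated anew at each test. Besides its body, an
  iteration costs \<open>acost b + 3\<close> for the test and 6 for the increment; outside the
  iterations there remain the initialisation, \<open>acost a + 2\<close>, and the failing
  test.\<close>

definition For :: "vname \<Rightarrow> aexp \<Rightarrow> aexp \<Rightarrow> com \<Rightarrow> com" where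
  "For x a b p = Seq (Assign x a)
     (While (Less (Var x) b) (Seq p (Assign x (Plus (Var x) (N 1)))))"

lemma writes_For [simp]: "writes (For x a b p) = insert x (writes p)"
  by (auto simp: For_def)

text \<open>The cost of an iteration may exceed \<open>T i\<close> if the potential \<open>\<Phi>\<close> pays for it.\<close>

lemma wp_For_potential:
  assumes init: "J (aval a s) s" "aval a s \<le> hi"
    and J_x: "\<And>i s v. J i s \<Longrightarrow> J i (store s x 0 v)"
    and \<Phi>_x: "\<And>s v. \<Phi> (store s x 0 v) = \<Phi> s"
    and hi: "\<And>i s. J i s \<Longrightarrow> aval b s = hi"
    and body: "\<And>i s. aval a s0 \<le> i \<Longrightarrow> i < hi \<Longrightarrow> J i s \<Longrightarrow> s x 0 = i \<Longrightarrow>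
      wp p (\<lambda>t s'. J (Suc i) s' \<and> s' x 0 = i \<and> t + \<Phi> s' \<le> T i + \<Phi> s) s"
    and post: "\<And>t s'. J hi s' \<Longrightarrow>
      t + \<Phi> s' \<le> (\<Sum>i=aval a s..<hi. T i + acost b + 9) + acost a + acost b + 5 + \<Phi> s \<Longrightarrow> Q t s'"
    and s0: "s0 = s"
  shows "wp (For x a b p) Q s"
proof -
  let ?W = "While (Less (Var x) b) (Seq p (Assign x (Plus (Var x) (N 1))))"
  have loop: "wp ?W Q s" if "J i s" "s x 0 = i" "aval a s0 \<le> i" "i \<le> hi"
    "\<And>t s'. J hi s' \<Longrightarrow> t + \<Phi> s' \<le> (\<Sum>i=i..<hi. T i + acost b + 9) + acost b + 3 + \<Phi> s \<Longrightarrow> Q t s'"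
    for i s Q
    using that
  proof (induction "hi - i" arbitrary: i s Q)
    case 0
    then show ?case using hi[of i s] by (intro wp_While_unfold) simp
  next
    case (Suc d)
    then have i: "i < hi" by simp
    have "wp p (\<lambda>t1 s1. wp ?W (\<lambda>t2. Q (3 + acost b + (t1 + 6) + t2)) (store s1 x 0 (Suc i))) s"
    proof (rule wp_mono[OF body[OF Suc.prems(3) i Suc.prems(1,2)]], elim conjE)
      fix t1 s1 assume 1: "J (Suc i) s1" "s1 x 0 = i" "t1 + \<Phi> s1 \<le> T i + \<Phi> s"
      show "wp ?W (\<lambda>t2. Q (3 + acost b + (t1 + 6) + t2)) (store s1 x 0 (Suc i))"
      proof (rule Suc.hyps(1)[of "Suc i"])
        fix t s'
        assume 2: "J hi s'" "t + \<Phi> s' \<le> (\<Sum>i=Suc i..<hi. T i + acost b + 9) + acost b + 3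
          + \<Phi> (store s1 x 0 (Suc i))"
        show "Q (3 + acost b + (t1 + 6) + t) s'"
          by (rule Suc.prems(5)[OF 2(1)])
            (use 1(3) 2(2) in \<open>simp add: sum.atLeast_Suc_lessThan[OF i] \<Phi>_x\<close>)
      qed (use Suc.hyps(2) Suc.prems i 1 J_x in \<open>auto simp: store_apply\<close>)
    qed
    then have "wp p (\<lambda>t1 s1. s1 x 0 = i \<longrightarrow>
        wp ?W (\<lambda>t2. Q (3 + acost b + (t1 + 6) + t2)) (store s1 x 0 (Suc (s1 x 0)))) s"
      by (rule wp_mono) simp
    moreover have "wp p (\<lambda>t1 s1. s1 x 0 = i) s"
      by (rule wp_mono[OF body[OF Suc.prems(3) i Suc.prems(1,2)]]) simp
    \<comment> \<open>Both postconditions belong to the same run of \<open>p\<close>, by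
      determinism.\<close>
    ultimately have "wp p (\<lambda>t1 s1.
        wp ?W (\<lambda>t2. Q (3 + acost b + (t1 + 6) + t2)) (store s1 x 0 (Suc (s1 x 0)))) s"
      unfolding wp_def by (metis exec_deterministic)
    then show ?case
      using hi[OF Suc.prems(1)] Suc.prems(2) i by (intro wp_While_unfold) (simp add: eval_nat_numeral)
  qed
  have "wp ?W (\<lambda>t. Q (2 + acost a + t)) (store s x 0 (aval a s))"
  proof (rule loop[of "aval a s"])
    fix t s' assume 1: "J hi s'" "t + \<Phi> s' \<le> (\<Sum>i=aval a s..<hi. T i + acost b + 9) + acost b + 3
      + \<Phi> (store s x 0 (aval a s))"
    show "Q (2 + acost a + t) s'" by (rule post[OF 1(1)]) (use 1(2) in \<open>simp add: \<Phi>_x\<close>)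
  qed (use init J_x s0 in \<open>auto simp: store_apply\<close>)
  then show ?thesis by (simp add: For_def)
qed

lemma wp_For:
  assumes init: "J (aval a s) s" "aval a s \<le> hi"
    and J_x: "\<And>i s v. J i s \<Longrightarrow> J i (store s x 0 v)"
    and hi: "\<And>i s. J i s \<Longrightarrow> aval b s = hi"
    and body: "\<And>i s'. aval a s \<le> i \<Longrightarrow> i < hi \<Longrightarrow> J i s' \<Longrightarrow> s' x 0 = i \<Longrightarrow>
      wp p (\<lambda>t s'. J (Suc i) s' \<and> s' x 0 = i \<and> t \<le> T i) s'"
    and post: "\<And>t s'. J hi s' \<Longrightarrow>
      t \<le> (\<Sum>i=aval a s..<hi. T i + acost b + 9) + acost a + acost b + 5 \<Longrightarrow> Q t s'"
  shows "wp (For x a b p) Q s"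
  by (rule wp_For_potential[where \<Phi> = "\<lambda>_. 0" and T = T and J = J and hi = hi, OF init J_x _ hi])
    (use body post in auto)

section \<open>The program and its correctness\<close>

text \<open>Marks are compared with \<open>m\<close> instead of being tested for zero, so the second
  search passes over the vertices of the first without any reset.\<close>

definition visit_com :: "nat \<Rightarrow> com" where
  "visit_com m = If (Less (Read ''seen'' (Var ''v'')) (N m))
     (Seq (Store ''seen'' (Var ''v'') (N m))
     (Seq (Store ''par'' (Var ''v'') (Var ''head''))
     (Seq (Store ''queue'' (Var ''tail'') (Var ''v''))
     (Assign ''tail'' (Plus (Var ''tail'') (N 1))))))
     Skip"

definition scan_com :: "nat \<Rightarrow> com" where
  "scan_com m =
     Seq (Assign ''u'' (Read ''queue'' (Var ''head'')))
     (Seq (For ''j'' (Read ''off'' (Var ''u'')) (Read ''off'' (Plus (Var ''u'') (N 1)))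
        (Seq (Assign ''v'' (Read ''adj'' (Var ''j''))) (visit_com m)))
     (Assign ''head'' (Plus (Var ''head'') (N 1))))"

definition bfs_com :: "nat \<Rightarrow> com" where
  "bfs_com m =
     Seq (Store ''seen'' (Var ''src'') (N m))
     (Seq (Store ''queue'' (Var ''tail'') (Var ''src''))
     (Seq (Assign ''head'' (Var ''tail''))
     (Seq (Assign ''tail'' (Plus (Var ''tail'') (N 1)))
     (While (Less (Var ''head'') (Var ''tail'')) (scan_com m)))))"

definition deg_exp :: "aexp \<Rightarrow> aexp" where
  "deg_exp a = Minus (Read ''off'' (Plus a (N 1))) (Read ''off'' a)"

text \<open>The last queue entry has the greatest parent position, so a parent that is not smaller
  is the same parent. The loop skips the source, for which the search sets no entry of
  \<open>par\<close>; in a component with one vertex it is empty.\<close>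

definition end_com :: com where
  "end_com =
     Seq (Assign ''w'' (Read ''queue'' (Minus (Var ''tail'') (N 1))))
     (For ''j'' (Plus (Var ''start'') (N 1)) (Var ''tail'')
        (Seq (Assign ''v'' (Read ''queue'' (Var ''j'')))
        (If (And (Not (Less (Read ''par'' (Var ''v'')) (Read ''par'' (Var ''w''))))
               (Less (deg_exp (Var ''v'')) (deg_exp (Var ''w''))))
          (Assign ''w'' (Var ''v'')) Skip)))"

text \<open>Vertices reached by the first search are marked 1, those reached by the second search 2.
  Both searches fill the same segment of the queue.\<close>

definition component_com :: com where
  "component_com =
     Seq (Assign ''start'' (Var ''tail''))
     (Seq (Assign ''src'' (Var ''a''))
     (Seq (bfs_com 1)
     (Seq end_com
     (Seq (Assign ''tail'' (Var ''start''))
     (Seq (Assign ''src'' (Var ''w''))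
     (bfs_com 2))))))"

definition queue_com :: com where
  "queue_com =
     Seq (For ''i'' (N 0) (Var ''n'') (Store ''seen'' (Var ''i'') (N 0)))
     (Seq (Assign ''tail'' (N 0))
     (For ''a'' (N 0) (Var ''n'') (If (Less (Read ''seen'' (Var ''a'')) (N 1)) component_com Skip)))"

locale graph_input = nat_graph +
  fixes off adj :: "nat \<Rightarrow> nat" and k :: nat
  assumes off_mono: "i < n \<Longrightarrow> off i \<le> off (Suc i)"
    and adj_bij: "i < n \<Longrightarrow> bij_betw adj {off i..<off (Suc i)} {j. A i j}"
begin

lemma deg_off: "i < n \<Longrightarrow> off (Suc i) - off i = deg i"
  using bij_betw_same_card[OF adj_bij] by (simp add: deg_def)

lemma adj_A: "i < n \<Longrightarrow> off i \<le> j \<Longrightarrow> j < off (Suc i) \<Longrightarrow> A i (adj j)"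
  using adj_bij unfolding bij_betw_def by fastforce

lemma adj_image: "i < n \<Longrightarrow> adj ` {off i..<off (Suc i)} = {j. A i j}"
  using adj_bij unfolding bij_betw_def by blast

definition inp :: "state \<Rightarrow> bool" where
  "inp s \<longleftrightarrow> s ''n'' 0 = n \<and> s ''k'' 0 = k \<and> s ''off'' = off \<and> s ''adj'' = adj"

lemma inp_store: "x \<notin> {''n'', ''k'', ''off'', ''adj''} \<Longrightarrow> inp (store s x i m) \<longleftrightarrow> inp s"
  by (auto simp: inp_def store_apply)

subsection \<open>Breadth-first search\<close>

text \<open>The vertices at queue positions \<open>a\<close>, \dots, \<open>h - 1\<close> are finished, and the part \<open>X\<close> of the
  neighbourhood of \<open>q h\<close> has been scanned.\<close>

definition bfs_state ::
  "nat \<Rightarrow> nat set \<Rightarrow> (nat \<Rightarrow> nat) \<Rightarrow> (nat \<Rightarrow> nat) \<Rightarrow> nat \<Rightarrow> nat \<Rightarrow> nat set \<Rightarrow> bool" where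
  "bfs_state a U q p h t X \<longleftrightarrow> bfs_tree q p a t \<and> a \<le> h \<and> h \<le> t \<and> q ` {a..<t} \<subseteq> U \<and>
     (\<forall>i. a < i \<and> i < t \<longrightarrow> p (q i) \<le> h) \<and>
     (\<forall>i. a \<le> i \<and> i < h \<longrightarrow> (\<forall>v. A (q i) v \<longrightarrow> v \<in> q ` {a..<t})) \<and> X \<subseteq> q ` {a..<t}"

lemma bfs_state_start:
  assumes "w \<in> U" "w < n"
  shows "bfs_state a U (q(a := w)) p a (Suc a) {}"
  using assms unfolding bfs_state_def bfs_tree_def by auto

lemma bfs_state_next:
  assumes "bfs_state a U q p h t {v. A (q h) v}" "h < t"
  shows "bfs_state a U q p (Suc h) t {}"
  using assms unfolding bfs_state_def by (auto simp: less_Suc_eq le_SucI subset_iff)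

lemma image_push:
  fixes t :: nat
  shows "a \<le> t \<Longrightarrow> (q(t := v)) ` {a..<Suc t} = insert v (q ` {a..<t})"
  by (auto simp: atLeastLessThanSuc)

text \<open>All neighbours of finished vertices are already queued, so none of those vertices is
  adjacent to the new \<open>v\<close>, and \<open>h\<close> is its first possible parent. No
  earlier parent exceeds \<open>h\<close>, so parents remain monotone.\<close>

lemma bfs_state_push:
  assumes S: "bfs_state a U q p h t X" and h: "h < t" and v: "A (q h) v" "v \<in> U" "v \<notin> q ` {a..<t}"
  shows "bfs_state a U (q(t := v)) (p(v := h)) h (Suc t) (insert v X)"
proof -
  let ?q = "q(t := v)" and ?p = "p(v := h)"
  have T: "bfs_tree q p a t" and ah: "a \<le> h" "h \<le> t" and U: "q ` {a..<t} \<subseteq> U"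
    and ph: "\<And>i. a < i \<Longrightarrow> i < t \<Longrightarrow> p (q i) \<le> h"
    and fin: "\<And>i v. a \<le> i \<Longrightarrow> i < h \<Longrightarrow> A (q i) v \<Longrightarrow> v \<in> q ` {a..<t}" and X: "X \<subseteq> q ` {a..<t}"
    using S unfolding bfs_state_def by blast+
  have at: "a \<le> t" using ah by simp
  have qv: "q i \<noteq> v" if "a \<le> i" "i < t" for i using v(3) that by auto
  have pq: "?p (q i) = p (q i)" if "a \<le> i" "i < t" for i using qv[OF that] by simp
  have no: "\<not> A (q j) v" if "a \<le> j" "j < h" for j using fin[OF that] v(3) by blast
  have inj: "inj_on ?q {a..<Suc t}"
  proof (rule inj_onI)
    fix i j assume "i \<in> {a..<Suc t}" "j \<in> {a..<Suc t}" "?q i = ?q j"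
    then show "i = j"
      using qv[of i] qv[of j] bfs_neq[OF T, of i j] by (cases "i = t"; cases "j = t") auto
  qed
  have "bfs_tree ?q ?p a (Suc t)"
    unfolding bfs_tree_def
  proof (intro conjI allI impI)
    show "a < Suc t" using at by simp
    show "inj_on ?q {a..<Suc t}" by (rule inj)
    show "?q i < n" if "a \<le> i \<and> i < Suc t" for i
      using that bfs_less[OF T, of i] A_less2[OF v(1)] by (auto simp: less_Suc_eq)
    fix i
    {
      assume i: "a < i \<and> i < Suc t"
      show "a \<le> ?p (?q i)" "?p (?q i) < i" "A (?q (?p (?q i))) (?q i)"
        using i bfs_parent[OF T, of i] pq[of i] ah h v by (auto simp: less_Suc_eq)
      fix j assume "a \<le> j \<and> j < ?p (?q i)"
      then show "\<not> A (?q j) (?q i)"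
        using i bfs_first[OF T, of i j] bfs_parent[OF T, of i] pq[of i] no h
        by (cases "i = t") force+
    next
      fix j assume "a < i \<and> i \<le> j \<and> j < Suc t"
      then show "?p (?q i) \<le> ?p (?q j)"
        using pq[of i] pq[of j] ph[of i] bfs_mono[OF T, of i j]
        by (cases "j = t"; cases "i = t") auto
    }
  qed
  moreover have "?p (?q i) \<le> h" if "a < i" "i < Suc t" for i
    using that ph[of i] pq[of i] by (cases "i = t") auto
  moreover have "x \<in> insert v (q ` {a..<t})" if "a \<le> i" "i < h" "A (?q i) x" for i x
    using that fin[of i x] h by auto
  ultimately show ?thesis
    using ah U v(2) X unfolding bfs_state_def image_push[OF at] by auto
qed

lemma bfs_state_finished:
  assumes "bfs_state a U q p t t X"
  shows "bfs_tree q p a t" "closed (q ` {a..<t})" "q ` {a..<t} \<subseteq> U"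
  using assms unfolding bfs_state_def closed_def by auto

definition unseen :: "state \<Rightarrow> nat \<Rightarrow> nat set" where
  "unseen s m = {v. v < n \<and> s ''seen'' v < m}"

definition bfs_inv :: "state \<Rightarrow> nat \<Rightarrow> nat \<Rightarrow> nat \<Rightarrow> nat set \<Rightarrow> state \<Rightarrow> bool" where
  "bfs_inv s0 a m w X s \<longleftrightarrow> inp s \<and>
     bfs_state a (unseen s0 m) (s ''queue'') (s ''par'') (s ''head'' 0) (s ''tail'' 0) X \<and>
     s ''queue'' a = w \<and>
     (\<forall>v. s ''seen'' v =
        (if v \<in> s ''queue'' ` {a..<s ''tail'' 0} then m else s0 ''seen'' v)) \<and>
     (\<forall>i<a. s ''queue'' i = s0 ''queue'' i)"

lemma bfs_inv_store:
  assumes "x \<notin> {''n'', ''k'', ''off'', ''adj'', ''queue'', ''par'', ''head'', ''tail'', ''seen''}"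
  shows "bfs_inv s0 a m w X (store s x i y) \<longleftrightarrow> bfs_inv s0 a m w X s"
proof -
  have "store s x i y z = s z"
    if "z \<in> {''n'', ''k'', ''off'', ''adj'', ''queue'', ''par'', ''head'', ''tail'', ''seen''}" for z
    using assms that unfolding store_def by (metis fun_upd_apply)
  then show ?thesis unfolding bfs_inv_def inp_def by simp
qed

text \<open>Closedness of the initially unseen set puts the neighbour \<open>v\<close> into it. So a
  mark that is not below \<open>m\<close> can only come from the current search, and then
  \<open>v\<close> is in the current queue segment.\<close>

lemma wp_visit:
  assumes inv: "bfs_inv s0 a m w X s" and h: "s ''head'' 0 < s ''tail'' 0"
    and v: "A (s ''queue'' (s ''head'' 0)) (s ''v'' 0)"
    and cl: "closed (unseen s0 m)"
  shows "wp (visit_com m) (\<lambda>t s'. bfs_inv s0 a m w (insert (s ''v'' 0) X) s' \<and>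
    s' ''head'' 0 < s' ''tail'' 0 \<and>
    (\<forall>i\<le>s ''head'' 0. s' ''queue'' i = s ''queue'' i) \<and> t \<le> 40) s"
proof -
  let ?q = "s ''queue''" and ?h = "s ''head'' 0" and ?t = "s ''tail'' 0" and ?v = "s ''v'' 0"
  have st: "bfs_state a (unseen s0 m) ?q (s ''par'') ?h ?t X" and "inp s"
    and seen: "\<And>v. s ''seen'' v = (if v \<in> ?q ` {a..<?t} then m else s0 ''seen'' v)"
    and old: "\<forall>i<a. ?q i = s0 ''queue'' i" and w: "?q a = w"
    using inv unfolding bfs_inv_def by blast+
  have ah: "a \<le> ?h" using st unfolding bfs_state_def by auto
  have "?q ?h \<in> ?q ` {a..<?t}" using ah h by auto
  then have "?q ?h \<in> unseen s0 m" using st unfolding bfs_state_def by blast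
  then have vU: "?v \<in> unseen s0 m" using cl v unfolding closed_def by blast
  show ?thesis
  proof (cases "?v \<in> ?q ` {a..<?t}")
    case True
    then have "\<not> s ''seen'' ?v < m" using seen by simp
    moreover have "bfs_state a (unseen s0 m) ?q (s ''par'') ?h ?t (insert ?v X)"
      using st True unfolding bfs_state_def by simp
    ultimately show ?thesis
      using \<open>inp s\<close> seen old w h unfolding visit_com_def bfs_inv_def by simp
  next
    case False
    have at: "a \<le> ?t" "a < ?t" using ah h by auto
    have "s ''seen'' ?v < m" using seen vU False by (auto simp: unseen_def)
    then show ?thesis
      using bfs_state_push[OF st h v vU False] \<open>inp s\<close> seen old w h at
      unfolding visit_com_def bfs_inv_def
      by (simp add: store_apply inp_store image_push cong del: image_cong_simp)
  qed
qed

lemma wp_scan: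
  assumes inv: "bfs_inv s0 a m w {} s" and h: "s ''head'' 0 < s ''tail'' 0"
    and cl: "closed (unseen s0 m)"
  shows "wp (scan_com m) (\<lambda>t s'. bfs_inv s0 a m w {} s' \<and> s' ''head'' 0 = Suc (s ''head'' 0) \<and>
    (\<forall>i\<le>s ''head'' 0. s' ''queue'' i = s ''queue'' i) \<and>
    s ''queue'' (s ''head'' 0) \<in> unseen s0 m \<and>
    t \<le> 80 + 80 * deg (s ''queue'' (s ''head'' 0))) s"
proof -
  let ?h = "s ''head'' 0"
  let ?u = "s ''queue'' ?h"
  have "?u \<in> s ''queue'' ` {a..<s ''tail'' 0}"
    using inv h by (auto simp: bfs_inv_def bfs_state_def)
  then have uU: "?u \<in> unseen s0 m" using inv by (auto simp: bfs_inv_def bfs_state_def)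
  then have u: "?u < n" by (simp add: unseen_def)
  have off: "s ''off'' = off" using inv by (simp add: bfs_inv_def inp_def)
  define J where "J j s' \<longleftrightarrow> bfs_inv s0 a m w (adj ` {off ?u..<j}) s' \<and> s' ''u'' 0 = ?u \<and>
    s' ''head'' 0 = ?h \<and> ?h < s' ''tail'' 0 \<and> (\<forall>i\<le>?h. s' ''queue'' i = s ''queue'' i)" for j s'
  show ?thesis
    unfolding scan_com_def wp_Seq wp_Store
  proof (rule wp_For[where J = J and hi = "off (Suc ?u)" and T = "\<lambda>_. 50"], goal_cases)
    case 1
    then show ?case using inv h by (simp add: J_def store_apply bfs_inv_store off)
  next
    case 2
    then show ?case using off_mono[OF u] by (simp add: store_apply off)
  next
    case (3 i s v)
    then show ?case by (simp add: J_def store_apply bfs_inv_store)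
  next
    case (4 i s)
    then have "s ''off'' = off" by (simp add: J_def bfs_inv_def inp_def)
    then show ?case using 4 by (simp add: J_def)
  next
    case (5 i s')
    let ?s = "store s' ''v'' 0 (adj i)"
    have i: "off ?u \<le> i" "i < off (Suc ?u)" using 5(1,2) by (simp_all add: store_apply off)
    have adj: "s' ''adj'' = adj" using 5(3) by (simp add: J_def bfs_inv_def inp_def)
    have "wp (visit_com m) (\<lambda>t s''. bfs_inv s0 a m w (insert (?s ''v'' 0) (adj ` {off ?u..<i})) s'' \<and>
      s'' ''head'' 0 < s'' ''tail'' 0 \<and>
      (\<forall>i\<le>?s ''head'' 0. s'' ''queue'' i = ?s ''queue'' i) \<and> t \<le> 40) ?s"
    proof (rule wp_visit)
      show "bfs_inv s0 a m w (adj ` {off ?u..<i}) ?s" using 5(3) by (simp add: J_def bfs_inv_store)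
    qed (use 5(3) adj_A[OF u i] cl in \<open>simp_all add: J_def store_apply\<close>)
    then have "wp (visit_com m) (\<lambda>t s''. J (Suc i) s'' \<and> s'' ''j'' 0 = i \<and> 5 + t \<le> 50) ?s"
    proof (rule wp_frame)
      fix t :: nat and s'' :: state
      assume a: "bfs_inv s0 a m w (insert (?s ''v'' 0) (adj ` {off ?u..<i})) s'' \<and>
        s'' ''head'' 0 < s'' ''tail'' 0 \<and>
        (\<forall>i\<le>?s ''head'' 0. s'' ''queue'' i = ?s ''queue'' i) \<and> t \<le> 40"
        and f: "\<And>x. x \<notin> writes (visit_com m) \<Longrightarrow> s'' x = ?s x"
      have "s'' ''u'' = s' ''u''" "s'' ''head'' = s' ''head''" "s'' ''j'' = s' ''j''"
        using f by (simp_all add: visit_com_def store_apply)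
      then show "J (Suc i) s'' \<and> s'' ''j'' 0 = i \<and> 5 + t \<le> 50"
        using a 5(3,4) i by (simp add: J_def store_apply atLeastLessThanSuc)
    qed
    then show ?case using adj 5(4) by simp
  next
    case (6 t s')
    then have J: "J (off (Suc ?u)) s'" and t: "t \<le> deg ?u * 64 + 20"
      by (simp_all add: store_apply off deg_off[OF u])
    have "bfs_inv s0 a m w {v. A ?u v} s'" using J adj_image[OF u] by (simp add: J_def)
    then have "bfs_inv s0 a m w {} (store s' ''head'' 0 (Suc ?h))"
      using J bfs_state_next[of a _ "s' ''queue''" _ ?h]
      by (simp add: bfs_inv_def store_apply inp_store J_def)
    then show ?case using J t uU by (simp add: J_def store_apply)
  qed
qed

lemma sum_diff_le:
  fixes W :: "'b \<Rightarrow> nat"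
  assumes "finite U" "C \<subseteq> U" "t + sum W (U - C) \<le> sum W U + c"
  shows "t \<le> sum W C + c"
  using assms sum.subset_diff[OF assms(2,1), of W] by simp

text \<open>The component is not known beforehand, so the potential starts with the weight of all
  unseen vertices and loses that of each scanned vertex. What remains at the end is the weight of
  the unreached vertices, which \<open>sum_diff_le\<close> cancels.\<close>

lemma wp_bfs:
  assumes inp: "inp s" and src: "s ''src'' 0 \<in> unseen s m"
    and cl: "closed (unseen s m)"
  shows "wp (bfs_com m) (\<lambda>t s'. bfs_inv s (s ''tail'' 0) m (s ''src'' 0) {} s' \<and>
    s' ''head'' 0 = s' ''tail'' 0 \<and>
    t \<le> (\<Sum>v\<in>s' ''queue'' ` {s ''tail'' 0..<s' ''tail'' 0}. 100 + 100 * deg v) + 50) s"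
proof -
  let ?a = "s ''tail'' 0" and ?w = "s ''src'' 0" and ?U = "unseen s m"
  let ?W = "\<lambda>v. 100 + 100 * deg v"
  have fin: "finite ?U" by (simp add: unseen_def)
  define \<Phi> where "\<Phi> s' = (\<Sum>v\<in>?U - s' ''queue'' ` {?a..<s' ''head'' 0}. ?W v)" for s'
  show ?thesis
    unfolding bfs_com_def wp_Seq wp_Store
  proof (rule wp_While[where I = "bfs_inv s ?a m ?w {}" and \<Phi> = \<Phi>], goal_cases)
    case 1
    show ?case
      using inp src bfs_state_start[OF src, of ?a "s ''queue''" "s ''par''"]
      by (auto simp: bfs_inv_def store_apply inp_store unseen_def)
  next
    case (2 s')
    let ?h = "s' ''head'' 0"
    have h: "?h < s' ''tail'' 0" using 2 by simp
    have ah: "?a \<le> ?h" and inj: "inj_on (s' ''queue'') {?a..<s' ''tail'' 0}"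
      using 2(1) bfs_inj unfolding bfs_inv_def bfs_state_def by blast+
    show ?case
    proof (rule wp_mono[OF wp_scan[OF 2(1) h cl]], elim conjE)
      fix t :: nat and s'' :: state
      assume 3: "bfs_inv s ?a m ?w {} s''" "s'' ''head'' 0 = Suc ?h"
        "\<forall>i\<le>?h. s'' ''queue'' i = s' ''queue'' i" "s' ''queue'' ?h \<in> ?U"
        "t \<le> 80 + 80 * deg (s' ''queue'' ?h)"
      let ?D = "?U - s' ''queue'' ` {?a..<?h}"
      have "s'' ''queue'' ` {?a..<Suc ?h} = insert (s' ''queue'' ?h) (s' ''queue'' ` {?a..<?h})"
        using 3(3) ah by (auto simp: atLeastLessThanSuc)
      then have "?U - s'' ''queue'' ` {?a..<s'' ''head'' 0} = ?D - {s' ''queue'' ?h}"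
        using 3(2) by auto
      moreover have "s' ''queue'' ?h \<in> ?D"
        using 3(4) ah h inj_on_image_mem_iff[OF inj, of ?h "{?a..<?h}"] by simp
      ultimately have "\<Phi> s' = ?W (s' ''queue'' ?h) + \<Phi> s''"
        unfolding \<Phi>_def using fin sum.remove[of ?D "s' ''queue'' ?h" ?W] by simp
      then show "bfs_inv s ?a m ?w {} s'' \<and>
        bcost (Less (Var ''head'') (Var ''tail'')) + t + \<Phi> s'' \<le> \<Phi> s'"
        using 3(1,5) by simp
    qed
  next
    case (3 t s')
    have "s' ''head'' 0 \<le> s' ''tail'' 0" using 3(1) by (auto simp: bfs_inv_def bfs_state_def)
    then have ht: "s' ''head'' 0 = s' ''tail'' 0" using 3(2) by simp
    let ?C = "s' ''queue'' ` {?a..<s' ''tail'' 0}"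
    have "?C \<subseteq> ?U" using 3(1) by (auto simp: bfs_inv_def bfs_state_def)
    moreover have "t + \<Phi> s' \<le> sum ?W ?U + 7"
    proof -
      have "\<Phi> s1 \<le> sum ?W ?U" for s1 unfolding \<Phi>_def using fin by (intro sum_mono2) auto
      from order.trans[OF 3(3) add_right_mono[OF this]] show ?thesis by simp
    qed
    ultimately have "t \<le> sum ?W ?C + 7"
      unfolding \<Phi>_def ht by (rule sum_diff_le[OF fin])
    then show ?case using 3(1) ht by simp
  qed
qed

subsection \<open>One connected component\<close>

lemma wp_end:
  assumes inp: "inp s" and t: "bfs_tree (s ''queue'') (s ''par'') (s ''start'' 0) (s ''tail'' 0)"
  shows "wp end_com (\<lambda>t s'.
    end_choice (s ''queue'') (s ''par'') (s ''start'' 0) (s ''tail'' 0) (s' ''w'' 0) \<and>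
    t \<le> 100 * (s ''tail'' 0 - s ''start'' 0) + 50) s"
proof -
  let ?q = "s ''queue''" and ?p = "s ''par''" and ?a = "s ''start'' 0" and ?b = "s ''tail'' 0"
  define J where "J j s' \<longleftrightarrow> inp s' \<and> s' ''queue'' = ?q \<and> s' ''par'' = ?p \<and> s' ''tail'' 0 = ?b \<and>
    (s' ''w'' 0 = ?q ?a \<and> ?b = Suc ?a \<or>
     (\<exists>m. s' ''w'' 0 = ?q m \<and> ?a < m \<and> m < ?b \<and> ?p (?q m) = ?p (?q (?b - 1)) \<and>
      (\<forall>i. ?a < i \<and> i < j \<and> ?p (?q i) = ?p (?q (?b - 1)) \<longrightarrow> deg (?q m) \<le> deg (?q i))))" for j s'
  have ab: "?a < ?b" by (rule bfs_ab[OF t])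
  show ?thesis
    unfolding end_com_def wp_Seq wp_Store
  proof (rule wp_For[where J = J and hi = "?b" and T = "\<lambda>_. 70"], goal_cases)
    case 1
    have "?b = Suc ?a \<or> ?a < ?b - 1" using ab by auto
    then show ?case using inp ab by (auto simp: J_def store_apply inp_store)
  next
    case 2
    then show ?case using ab by (simp add: store_apply)
  next
    case (3 i s v)
    then show ?case by (simp add: J_def store_apply inp_store)
  next
    case (4 i s)
    then show ?case by (simp add: J_def)
  next
    case (5 i s')
    have i: "?a < i" "i < ?b" using 5(1,2) by (simp_all add: store_apply)
    then obtain m where m: "s' ''w'' 0 = ?q m" "?a < m" "m < ?b" "?p (?q m) = ?p (?q (?b - 1))"
      "\<And>j. ?a < j \<Longrightarrow> j < i \<Longrightarrow> ?p (?q j) = ?p (?q (?b - 1)) \<Longrightarrow> deg (?q m) \<le> deg (?q j)"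
      using 5(3) unfolding J_def by auto
    have s': "inp s'" "s' ''queue'' = ?q" "s' ''par'' = ?p" "s' ''tail'' 0 = ?b" "s' ''off'' = off"
      using 5(3) by (auto simp: J_def inp_def)
    have degs: "off (Suc (?q i)) - off (?q i) = deg (?q i)" "off (Suc (?q m)) - off (?q m) = deg (?q m)"
      using bfs_less[OF t] i m(2,3) by (auto intro!: deg_off)
    \<comment> \<open>No parent position exceeds that of the last entry, so the test for not being
      smaller detects equality.\<close>
    have "?p (?q i) \<le> ?p (?q (?b - 1))" using bfs_mono[OF t i(1)] i(2) by simp
    then have p: "\<not> ?p (?q i) < ?p (?q m) \<longleftrightarrow> ?p (?q i) = ?p (?q (?b - 1))" using m(4) by auto
    have J_new: "J (Suc i) (store (store s' ''v'' 0 (?q i)) ''w'' 0 (?q i))"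
      if "?p (?q i) = ?p (?q (?b - 1))" "deg (?q i) < deg (?q m)"
    proof -
      have "deg (?q i) \<le> deg (?q j)" if "?a < j" "j < i" "?p (?q j) = ?p (?q (?b - 1))" for j
        using m(5)[OF that] \<open>deg (?q i) < deg (?q m)\<close> by simp
      then show ?thesis
        using s'(1-4) i that by (auto simp: J_def store_apply inp_store less_Suc_eq intro!: exI[of _ i])
    qed
    have J_old: "J (Suc i) (store s' ''v'' 0 (?q i))"
      if "?p (?q i) = ?p (?q (?b - 1)) \<Longrightarrow> deg (?q m) \<le> deg (?q i)"
      using s'(1-4) m i that
      by (auto simp: J_def store_apply inp_store less_Suc_eq intro!: exI[of _ m])
    show ?case
      using J_new J_old s' m(1) degs p 5(4)
      by (auto simp: deg_exp_def store_apply)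
  next
    case (6 t s')
    then show ?case by (simp add: J_def end_choice_def store_apply)
  qed
qed

lemma writes_bfs_com:
  "writes (bfs_com m) = {''seen'', ''queue'', ''head'', ''tail'', ''u'', ''j'', ''v'', ''par''}"
  by (auto simp: bfs_com_def scan_com_def visit_com_def)

lemma writes_end_com: "writes end_com = {''w'', ''j'', ''v''}"
  by (auto simp: end_com_def)

definition queue_inv :: "state \<Rightarrow> bool" where
  "queue_inv s \<longleftrightarrow> inp s \<and> queue_ok (s ''queue'') (s ''tail'' 0) \<and>
     (\<forall>v<n. s ''seen'' v = (if v \<in> s ''queue'' ` {..<s ''tail'' 0} then 2 else 0))"

text \<open>A component pays for two searches, each with weight \<open>100 + 100 * deg v\<close> per
  vertex, and for the choice of an end at 100 per vertex. The factor 600 leaves room for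
  constants.\<close>

definition queue_potential :: "state \<Rightarrow> nat" where
  "queue_potential s = (\<Sum>v\<in>{..<n} - s ''queue'' ` {..<s ''tail'' 0}. 600 + 600 * deg v)"

lemma closed_Diff: "closed X \<Longrightarrow> closed ({..<n} - X)"
  using A_sym A_less2 unfolding closed_def by blast

lemma wp_component:
  assumes inv: "queue_inv s" and x: "s ''a'' 0 < n" "s ''a'' 0 \<notin> s ''queue'' ` {..<s ''tail'' 0}"
  shows "wp component_com (\<lambda>t s'. queue_inv s' \<and> s' ''a'' 0 = s ''a'' 0 \<and>
    s ''queue'' ` {..<s ''tail'' 0} \<subseteq> s' ''queue'' ` {..<s' ''tail'' 0} \<and>
    s ''a'' 0 \<in> s' ''queue'' ` {..<s' ''tail'' 0} \<and>
    t + queue_potential s' \<le> queue_potential s) s"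
proof -
  let ?x = "s ''a'' 0" and ?q = "s ''queue''" and ?a = "s ''tail'' 0"
  let ?M = "?q ` {..<?a}"
  let ?U = "{..<n} - ?M"
  let ?s1 = "store (store s ''start'' 0 ?a) ''src'' 0 ?x"
  have inp: "inp s" and q: "queue_ok ?q ?a"
    and seen: "\<And>v. v < n \<Longrightarrow> s ''seen'' v = (if v \<in> ?M then 2 else 0)"
    using inv unfolding queue_inv_def by auto
  have M: "closed ?M" using q unfolding queue_ok_def by blast
  have U1: "unseen ?s1 1 = ?U" using seen by (auto simp: unseen_def store_apply)
  have 1: "wp (bfs_com 1) (\<lambda>t s'. bfs_inv ?s1 ?a 1 ?x {} s' \<and> s' ''head'' 0 = s' ''tail'' 0 \<and>
    t \<le> (\<Sum>v\<in>s' ''queue'' ` {?a..<s' ''tail'' 0}. 100 + 100 * deg v) + 50) ?s1"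
    using wp_bfs[of ?s1 1] inp x closed_Diff[OF M] unfolding U1
    by (simp add: store_apply inp_store)
  have "wp (Seq (bfs_com 1) (Seq end_com (Seq (Assign ''tail'' (Var ''start''))
      (Seq (Assign ''src'' (Var ''w'')) (bfs_com 2))))) (\<lambda>t s'. queue_inv s' \<and> s' ''a'' 0 = ?x \<and>
    ?M \<subseteq> s' ''queue'' ` {..<s' ''tail'' 0} \<and> ?x \<in> s' ''queue'' ` {..<s' ''tail'' 0} \<and>
    t + queue_potential s' + 10 \<le> queue_potential s) ?s1"
    unfolding wp_Seq wp_Store
  proof (rule wp_frame[OF 1], elim conjE)
    fix t1 :: nat and s2 :: state
    let ?q1 = "s2 ''queue''" and ?p1 = "s2 ''par''" and ?b = "s2 ''tail'' 0"
    let ?C = "?q1 ` {?a..<?b}"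
    assume 2: "bfs_inv ?s1 ?a 1 ?x {} s2" "s2 ''head'' 0 = ?b"
      and t1: "t1 \<le> (\<Sum>v\<in>?C. 100 + 100 * deg v) + 50"
      and f2: "\<And>y. y \<notin> writes (bfs_com 1) \<Longrightarrow> s2 y = ?s1 y"
    have s2: "s2 ''start'' 0 = ?a" "s2 ''a'' 0 = ?x"
      using f2[of "''start''"] f2[of "''a''"] by (simp_all add: writes_bfs_com store_apply)
    have inp2: "inp s2" and st2: "bfs_state ?a ?U ?q1 ?p1 ?b ?b {}" and src: "?q1 ?a = ?x"
      and seen2: "\<And>v. s2 ''seen'' v = (if v \<in> ?C then 1 else s ''seen'' v)"
      and old2: "\<forall>i<?a. ?q1 i = ?q i"
      using 2 unfolding bfs_inv_def U1 by (simp_all add: store_apply)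
    note T1 = bfs_state_finished[OF st2]
    have finC: "finite ?C" by simp
    have cardC: "card ?C = ?b - ?a" using card_image[OF bfs_inj[OF T1(1)]] by simp
    have wpe: "wp end_com (\<lambda>t s'. end_choice ?q1 ?p1 ?a ?b (s' ''w'' 0) \<and> t \<le> 100 * (?b - ?a) + 50) s2"
      using wp_end[OF inp2] T1(1) unfolding s2(1) by simp
    show "wp end_com (\<lambda>t2 s3. wp (bfs_com 2) (\<lambda>t s'. queue_inv s' \<and> s' ''a'' 0 = ?x \<and>
        ?M \<subseteq> s' ''queue'' ` {..<s' ''tail'' 0} \<and> ?x \<in> s' ''queue'' ` {..<s' ''tail'' 0} \<and>
        t1 + (t2 + (1 + acost (N 0) + acost (Var ''start'') + (1 + acost (N 0) + acost (Var ''w'') + t)))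
          + queue_potential s' + 10 \<le> queue_potential s)
      (store (store s3 ''tail'' (aval (N 0) s3) (aval (Var ''start'') s3)) ''src''
        (aval (N 0) (store s3 ''tail'' (aval (N 0) s3) (aval (Var ''start'') s3)))
        (aval (Var ''w'') (store s3 ''tail'' (aval (N 0) s3) (aval (Var ''start'') s3))))) s2"
    proof (rule wp_frame[OF wpe], elim conjE)
      fix t2 :: nat and s3 :: state
      let ?w = "s3 ''w'' 0"
      assume e: "end_choice ?q1 ?p1 ?a ?b ?w" and t2: "t2 \<le> 100 * (?b - ?a) + 50"
        and f3: "\<And>y. y \<notin> writes end_com \<Longrightarrow> s3 y = s2 y"
      have s3: "s3 ''start'' 0 = ?a" "s3 ''a'' 0 = ?x" "s3 ''seen'' = s2 ''seen''" "s3 ''queue'' = ?q1"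
        using f3 s2 by (simp_all add: writes_end_com)
      have inp3: "inp s3" using inp2 f3 by (simp add: inp_def writes_end_com)
      let ?s4 = "store (store s3 ''tail'' 0 ?a) ''src'' 0 ?w"
      have w: "?w \<in> ?C" using e bfs_ab[OF T1(1)] by (auto simp: end_choice_def)
      \<comment> \<open>Marks 1 from the first search are below 2, so the second search may use the
        same vertices as the first.\<close>
      have U4: "unseen ?s4 2 = ?U"
        using T1(3) seen seen2 by (auto simp: unseen_def store_apply s3(3) split: if_splits)
      have src4: "?s4 ''src'' 0 \<in> unseen ?s4 2"
        unfolding U4 using w T1(3) by (auto simp: store_apply)
      have inp4: "inp ?s4" using inp3 by (simp add: inp_store)
      have cl4: "closed (unseen ?s4 2)" unfolding U4 by (rule closed_Diff[OF M])
      have 4: "wp (bfs_com 2) (\<lambda>t s'. bfs_inv ?s4 ?a 2 ?w {} s' \<and> s' ''head'' 0 = s' ''tail'' 0 \<and>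
        t \<le> (\<Sum>v\<in>s' ''queue'' ` {?a..<s' ''tail'' 0}. 100 + 100 * deg v) + 50) ?s4"
        using wp_bfs[OF inp4 src4 cl4] by (simp add: store_apply)
      have "wp (bfs_com 2) (\<lambda>t s'. queue_inv s' \<and> s' ''a'' 0 = ?x \<and>
        ?M \<subseteq> s' ''queue'' ` {..<s' ''tail'' 0} \<and> ?x \<in> s' ''queue'' ` {..<s' ''tail'' 0} \<and>
        t1 + (t2 + (4 + (4 + t))) + queue_potential s' + 10 \<le> queue_potential s) ?s4"
      proof (rule wp_frame[OF 4], elim conjE)
        fix t3 :: nat and s5 :: state
        let ?q2 = "s5 ''queue''" and ?c = "s5 ''tail'' 0"
        let ?D = "?q2 ` {?a..<?c}"
        assume 5: "bfs_inv ?s4 ?a 2 ?w {} s5" "s5 ''head'' 0 = ?c"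
          and t3: "t3 \<le> (\<Sum>v\<in>?D. 100 + 100 * deg v) + 50"
          and f5: "\<And>y. y \<notin> writes (bfs_com 2) \<Longrightarrow> s5 y = ?s4 y"
        have s5: "s5 ''a'' 0 = ?x" using f5[of "''a''"] s3 by (simp add: writes_bfs_com store_apply)
        have inp5: "inp s5" and st5: "bfs_state ?a ?U ?q2 (s5 ''par'') ?c ?c {}" and src5: "?q2 ?a = ?w"
          and seen5: "\<And>v. s5 ''seen'' v = (if v \<in> ?D then 2 else s2 ''seen'' v)"
          and old5: "\<forall>i<?a. ?q2 i = ?q i"
          using 5 old2 unfolding bfs_inv_def U4 by (simp_all add: store_apply s3)
        note T2 = bfs_state_finished[OF st5]
        have disj: "?M \<inter> ?D = {}" using T2(3) by auto
        note step = queue_ok_step[OF q old2 old5 T1(1,2) e T2(1,2) src5 disj]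
        have ab: "?a < ?c" by (rule bfs_ab[OF T2(1)])
        have old: "?q2 ` {..<?a} = ?M" using old5 by (intro image_cong) auto
        have "?q2 ` {..<?c} = ?q2 ` {..<?a} \<union> ?D"
          using ab by (simp add: ivl_disj_un_one(2) flip: image_Un)
        then have all: "?q2 ` {..<?c} = ?M \<union> ?D" unfolding old .
        have x_in: "?x \<in> ?D"
          using src bfs_ab[OF T1(1)] unfolding step(3) by force
        have "queue_inv s5"
          unfolding queue_inv_def
        proof (intro conjI allI impI inp5 step(1))
          fix v assume "v < n"
          then show "s5 ''seen'' v = (if v \<in> ?q2 ` {..<?c} then 2 else 0)"
            using seen5[of v] seen2[of v] seen[of v] step(3) unfolding all by auto
        qed
        moreover have "t1 + (t2 + (4 + (4 + t3))) + queue_potential s5 + 10 \<le> queue_potential s"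
        proof -
          have "{..<n} - ?q2 ` {..<?c} = ?U - ?D" unfolding all by auto
          then have "queue_potential s = queue_potential s5 + (\<Sum>v\<in>?D. 600 + 600 * deg v)"
            unfolding queue_potential_def
            using sum.subset_diff[OF T2(3), of "\<lambda>v. 600 + 600 * deg v"] by simp
          moreover have "(\<Sum>v\<in>?D. 600 + 600 * deg v) = 6 * (\<Sum>v\<in>?D. 100 + 100 * deg v)"
            by (simp add: sum_distrib_left algebra_simps)
          \<comment> \<open>The component is nonempty, so this sum is at least 100, and the slack in
            the factor 6 absorbs the additive constants.\<close>
          moreover have "100 * card ?D \<le> (\<Sum>v\<in>?D. 100 + 100 * deg v)"
            using sum_bounded_below[of ?D 100 "\<lambda>v. 100 + 100 * deg v"] by simp
          moreover have "card ?D = ?b - ?a" using cardC step(3) by simp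
          moreover have "?b - ?a \<ge> 1" using bfs_ab[OF T1(1)] by simp
          ultimately show ?thesis using t1 t2 t3 unfolding step(3) by linarith
        qed
        ultimately show "queue_inv s5 \<and> s5 ''a'' 0 = ?x \<and>
          ?M \<subseteq> ?q2 ` {..<?c} \<and> ?x \<in> ?q2 ` {..<?c} \<and>
          t1 + (t2 + (4 + (4 + t3))) + queue_potential s5 + 10 \<le> queue_potential s"
          using s5 x_in unfolding all by blast
      qed
      then show "wp (bfs_com 2) (\<lambda>t s'. queue_inv s' \<and> s' ''a'' 0 = ?x \<and>
        ?M \<subseteq> s' ''queue'' ` {..<s' ''tail'' 0} \<and> ?x \<in> s' ''queue'' ` {..<s' ''tail'' 0} \<and>
        t1 + (t2 + (1 + acost (N 0) + acost (Var ''start'') + (1 + acost (N 0) + acost (Var ''w'') + t)))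
          + queue_potential s' + 10 \<le> queue_potential s)
      (store (store s3 ''tail'' (aval (N 0) s3) (aval (Var ''start'') s3)) ''src''
        (aval (N 0) (store s3 ''tail'' (aval (N 0) s3) (aval (Var ''start'') s3)))
        (aval (Var ''w'') (store s3 ''tail'' (aval (N 0) s3) (aval (Var ''start'') s3))))"
        by (simp add: s3 store_apply)
    qed
  qed
  then have "wp (Seq (bfs_com 1) (Seq end_com (Seq (Assign ''tail'' (Var ''start''))
      (Seq (Assign ''src'' (Var ''w'')) (bfs_com 2))))) (\<lambda>t s'. queue_inv s' \<and> s' ''a'' 0 = ?x \<and>
    ?M \<subseteq> s' ''queue'' ` {..<s' ''tail'' 0} \<and> ?x \<in> s' ''queue'' ` {..<s' ''tail'' 0} \<and>
    4 + (4 + t) + queue_potential s' \<le> queue_potential s) ?s1"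
    by (rule wp_mono) simp
  then show ?thesis
    unfolding component_com_def wp_Seq[of "Assign _ _"] wp_Store
    by (simp del: wp_Seq add: store_apply eval_nat_numeral)
qed

lemma queue_inv_store:
  assumes "x \<notin> {''n'', ''k'', ''off'', ''adj'', ''queue'', ''tail'', ''seen''}"
  shows "queue_inv (store s x i y) \<longleftrightarrow> queue_inv s"
    and "queue_potential (store s x i y) = queue_potential s"
proof -
  have "store s x i y z = s z"
    if "z \<in> {''n'', ''k'', ''off'', ''adj'', ''queue'', ''tail'', ''seen''}" for z
    using assms that unfolding store_def by (metis fun_upd_apply)
  then show "queue_inv (store s x i y) \<longleftrightarrow> queue_inv s"
    and "queue_potential (store s x i y) = queue_potential s"
    unfolding queue_inv_def queue_potential_def inp_def by simp_all
qed

text \<open>The order \<open>f\<close> only witnesses that an interval order exists. The potential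
  pays for the components, so the loop over all vertices adds a constant per vertex.\<close>

lemma wp_queue:
  fixes f :: "nat \<Rightarrow> int"
  assumes inp: "inp s" and f: "umbrella f"
  shows "wp queue_com (\<lambda>t s'. inp s' \<and> queue_ok (s' ''queue'') n \<and>
    t \<le> (\<Sum>v<n. 600 + 600 * deg v) + 100 * n + 100) s"
  unfolding queue_com_def wp_Seq
proof (rule wp_For[where J = "\<lambda>i s'. inp s' \<and> (\<forall>v<i. s' ''seen'' v = 0)" and hi = n
      and T = "\<lambda>_. 20"], goal_cases)
  case (6 t1 s1)
  let ?s2 = "store s1 ''tail'' 0 0"
  define J where "J i s' \<longleftrightarrow> queue_inv s' \<and> (\<forall>v<i. v \<in> s' ''queue'' ` {..<s' ''tail'' 0})" for i s'
  show ?case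
    unfolding wp_Store
  proof (rule wp_For_potential[where J = J and hi = n and T = "\<lambda>_. 20" and \<Phi> = queue_potential,
        OF _ _ _ _ _ _ _ refl], goal_cases)
    case 1
    show ?case using 6 queue_ok_0[OF f] by (simp add: J_def queue_inv_def store_apply inp_store)
  next
    case 2
    show ?case by simp
  next
    case (3 i s v)
    then show ?case by (simp add: J_def queue_inv_store store_apply)
  next
    case (4 s v)
    show ?case by (simp add: queue_inv_store)
  next
    case (5 i s)
    then show ?case by (simp add: J_def queue_inv_def inp_def)
  next
    case (6 i s')
    have inv: "queue_inv s'" using 6(3) by (simp add: J_def)
    have seen: "s' ''seen'' i = (if i \<in> s' ''queue'' ` {..<s' ''tail'' 0} then 2 else 0)"
      using inv 6(2) by (simp add: queue_inv_def)
    show ?case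
    proof (cases "i \<in> s' ''queue'' ` {..<s' ''tail'' 0}")
      case True
      then show ?thesis using 6 seen by (auto simp: J_def less_Suc_eq)
    next
      case False
      have "wp component_com (\<lambda>t s''. J (Suc i) s'' \<and> s'' ''a'' 0 = i \<and>
          5 + t + queue_potential s'' \<le> 20 + queue_potential s') s'"
        by (rule wp_mono[OF wp_component[OF inv]])
          (use 6 False in \<open>auto simp: J_def less_Suc_eq subset_iff\<close>)
      then show ?thesis using seen False 6(4) by simp
    qed
  next
    case (7 t s')
    let ?q = "s' ''queue''" and ?t = "s' ''tail'' 0"
    have q: "queue_ok ?q ?t" "inp s'" and all: "{..<n} \<subseteq> ?q ` {..<?t}"
      using 7(1) by (auto simp: J_def queue_inv_def)
    have "?q ` {..<?t} = {..<n}" using all q(1) by (auto simp: queue_ok_def)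
    then have "?t = n" using q(1) card_image[of ?q "{..<?t}"] by (simp add: queue_ok_def)
    moreover have "queue_potential ?s2 = (\<Sum>v<n. 600 + 600 * deg v)"
      by (simp add: queue_potential_def store_apply)
    ultimately show ?case using q 7(2) 6(2) by simp
  qed
qed (use inp in \<open>auto simp: inp_def store_apply less_Suc_eq\<close>)

end

subsection \<open>Counting sort and colouring\<close>

text \<open>The position of \<open>v\<close> in the stable sort by \<open>key\<close>.\<close>

definition rank :: "nat \<Rightarrow> (nat \<Rightarrow> 'b::linorder) \<Rightarrow> nat \<Rightarrow> nat" where
  "rank n key v = card {u. u < n \<and> (key u < key v \<or> key u = key v \<and> u < v)}"

lemma rank_less:
  assumes "u < n" "key u < key v \<or> key u = key v \<and> u < v"
  shows "rank n key u < rank n key v"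
  unfolding rank_def by (rule psubset_card_mono) (use assms in auto)

lemma rank_less_n:
  assumes "v < n"
  shows "rank n key v < n"
proof -
  have "{u. u < n \<and> (key u < key v \<or> key u = key v \<and> u < v)} \<subset> {..<n}"
    using assms by auto
  from psubset_card_mono[OF finite_lessThan this] show ?thesis
    by (simp only: rank_def card_lessThan)
qed

lemma bij_rank: "bij_betw (rank n key) {..<n} {..<n}"
proof -
  have inj: "inj_on (rank n key) {..<n}"
  proof (rule inj_onI, rule ccontr)
    fix u v assume uv: "u \<in> {..<n}" "v \<in> {..<n}" "rank n key u = rank n key v" "u \<noteq> v"
    then have "key u < key v \<or> key u = key v \<and> u < v \<or> key v < key u \<or> key v = key u \<and> v < u"
      by auto
    then show False using uv rank_less[of u n key v] rank_less[of v n key u] by auto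
  qed
  moreover have "rank n key ` {..<n} = {..<n}"
    by (rule endo_inj_surj) (use inj rank_less_n in auto)
  ultimately show ?thesis by (simp add: bij_betw_def)
qed

lemma rank_mono: "v < n \<Longrightarrow> rank n key u < rank n key v \<Longrightarrow> key u \<le> key v"
  using rank_less[of v n key u] by (meson leI order_less_asym)

lemma card_less_Suc:
  "card {v. v < Suc i \<and> P v} = card {v. v < i \<and> P v} + (if P i then 1 else 0)"
proof -
  have "{v. v < Suc i \<and> P v} = (if P i then insert i {v. v < i \<and> P v} else {v. v < i \<and> P v})"
    by (auto simp: less_Suc_eq)
  then show ?thesis by simp
qed

definition pos_com :: com where
  "pos_com = For ''i'' (N 0) (Var ''n'') (Store ''pos'' (Read ''queue'' (Var ''i'')) (Var ''i''))"

text \<open>Evaluates \<open>low_eq\<close>: one is subtracted from the position of a vertex for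
  each earlier neighbour.\<close>

definition low_com :: com where
  "low_com = For ''i'' (N 0) (Var ''n'')
     (Seq (Assign ''c'' (Read ''pos'' (Var ''i'')))
     (Seq (For ''j'' (Read ''off'' (Var ''i'')) (Read ''off'' (Plus (Var ''i'') (N 1)))
        (If (Less (Read ''pos'' (Read ''adj'' (Var ''j''))) (Read ''pos'' (Var ''i'')))
          (Assign ''c'' (Minus (Var ''c'') (N 1))) Skip))
     (Store ''low'' (Var ''i'') (Var ''c''))))"

definition key_exp :: "aexp \<Rightarrow> aexp" where
  "key_exp a = Plus (Plus (Read ''low'' a) (Read ''low'' a)) (deg_exp a)"

lemma acost_key_exp: "acost (key_exp (Var x)) = 17"
  by (simp add: key_exp_def deg_exp_def)

text \<open>Bucket \<open>x + 1\<close> counts the vertices with key \<open>x\<close>, so that the prefix sum up to bucket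
  \<open>x\<close> is the first position for key \<open>x\<close>.\<close>

definition count_com :: com where
  "count_com =
     Seq (For ''i'' (N 0) (Plus (Plus (Var ''n'') (Var ''n'')) (N 2)) (Store ''bucket'' (Var ''i'') (N 0)))
     (For ''i'' (N 0) (Var ''n'')
        (Seq (Assign ''c'' (Plus (key_exp (Var ''i'')) (N 1)))
        (Store ''bucket'' (Var ''c'') (Plus (Read ''bucket'' (Var ''c'')) (N 1)))))"

definition prefix_com :: com where
  "prefix_com =
     For ''i'' (N 0) (Plus (Plus (Var ''n'') (Var ''n'')) (N 1))
       (Store ''bucket'' (Plus (Var ''i'') (N 1))
         (Plus (Read ''bucket'' (Var ''i'')) (Read ''bucket'' (Plus (Var ''i'') (N 1)))))"

definition place_com :: com where
  "place_com =
     For ''i'' (N 0) (Var ''n'')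
       (Seq (Assign ''c'' (key_exp (Var ''i'')))
       (Seq (Store ''order'' (Read ''bucket'' (Var ''c'')) (Var ''i''))
       (Store ''bucket'' (Var ''c'') (Plus (Read ''bucket'' (Var ''c'')) (N 1)))))"

text \<open>The machine has no division, so \<open>c\<close> runs cyclically to provide the
  remainder modulo \<open>k\<close>. The last test is that of \<open>A_iff_le\<close> for the
  positions \<open>i\<close> and \<open>i + 2 * k\<close>.\<close>

definition color_com :: com where
  "color_com =
     Seq (Assign ''answer'' (N 1))
     (Seq (Assign ''c'' (N 0))
     (For ''i'' (N 0) (Var ''n'')
       (Seq (Assign ''v'' (Read ''order'' (Var ''i'')))
       (Seq (Store ''color'' (Var ''v'') (Var ''c''))
       (Seq (Assign ''c'' (Plus (Var ''c'') (N 1)))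
       (Seq (If (Less (Var ''c'') (Var ''k'')) Skip (Assign ''c'' (N 0)))
       (If (Less (Plus (Read ''low'' (Var ''v'')) (deg_exp (Var ''v'')))
              (Plus (Var ''i'') (Plus (Var ''k'') (Var ''k''))))
         Skip (Assign ''answer'' (N 0)))))))))"

definition main_com :: com where
  "main_com = Seq queue_com (Seq pos_com (Seq low_com (Seq count_com
     (Seq prefix_com (Seq place_com color_com)))))"

context graph_input
begin

lemma wp_pos:
  assumes "inp s" "inj_on (s ''queue'') {..<n}"
  shows "wp pos_com (\<lambda>t s'. inp s' \<and> (\<forall>i<n. s' ''pos'' (s ''queue'' i) = i) \<and> t \<le> 50 * n + 50) s"
  unfolding pos_com_def
proof (rule wp_For[where J = "\<lambda>i s'. inp s' \<and> s' ''queue'' = s ''queue'' \<and>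
      (\<forall>j<i. s' ''pos'' (s ''queue'' j) = j)" and hi = n and T = "\<lambda>_. 20"], goal_cases)
  case (5 i s')
  then have "s ''queue'' j \<noteq> s ''queue'' i" if "j < i" for j
    using assms(2) that by (auto simp: inj_on_def)
  then show ?case using 5 by (auto simp: store_apply inp_store less_Suc_eq)
qed (use assms in \<open>auto simp: inp_def store_apply\<close>)

lemma wp_low:
  assumes inp: "inp s" and g: "s ''pos'' = g" "bij_betw g {..<n} {..<n}"
  shows "wp low_com (\<lambda>t s'. inp s' \<and> (\<forall>v<n. s' ''low'' v = low g v) \<and>
    t \<le> (\<Sum>v<n. 100 + 100 * deg v) + 50) s"
  unfolding low_com_def
proof (rule wp_For[where J = "\<lambda>i s'. inp s' \<and> s' ''pos'' = g \<and> (\<forall>v<i. s' ''low'' v = low g v)"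
      and hi = n and T = "\<lambda>i. 80 + 80 * deg i"], goal_cases)
  case (5 i s')
  then have i: "i < n" and s': "inp s'" "s' ''pos'' = g" "s' ''i'' 0 = i" "s' ''off'' = off"
    "\<forall>v<i. s' ''low'' v = low g v"
    by (auto simp: inp_def)
  define cnt where "cnt j = card {j' \<in> {off i..<j}. g (adj j') < g i}" for j
  have cnt_Suc: "cnt (Suc j) = cnt j + (if g (adj j) < g i then 1 else 0)" if "off i \<le> j" for j
  proof -
    have "{j' \<in> {off i..<Suc j}. g (adj j') < g i} =
      (if g (adj j) < g i then insert j {j' \<in> {off i..<j}. g (adj j') < g i}
       else {j' \<in> {off i..<j}. g (adj j') < g i})"
      using that by (auto simp: less_Suc_eq)
    then show ?thesis by (simp add: cnt_def)
  qed
  \<comment> \<open>Each neighbour is listed once, so counting cells of \<open>adj\<close> counts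
    vertices.\<close>
  have "{u. A i u \<and> g u < g i} = {u \<in> adj ` {off i..<off (Suc i)}. g u < g i}"
    unfolding adj_image[OF i] by simp
  also have "\<dots> = adj ` {j' \<in> {off i..<off (Suc i)}. g (adj j') < g i}" by auto
  finally have "bij_betw adj {j' \<in> {off i..<off (Suc i)}. g (adj j') < g i}
      {u. A i u \<and> g u < g i}"
    using adj_bij[OF i] unfolding bij_betw_def by (auto elim: inj_on_subset)
  then have "cnt (off (Suc i)) = card {u. A i u \<and> g u < g i}"
    unfolding cnt_def by (rule bij_betw_same_card)
  then have low: "g i - cnt (off (Suc i)) = low g i"
    using low_eq[OF g(2) i] by simp
  define J where "J j s'' \<longleftrightarrow> inp s'' \<and> s'' ''pos'' = g \<and> (\<forall>v<i. s'' ''low'' v = low g v) \<and>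
    s'' ''i'' 0 = i \<and> s'' ''c'' 0 = g i - cnt j" for j s''
  show ?case
    unfolding wp_Seq wp_Store
  proof (rule wp_For[where J = J and hi = "off (Suc i)" and T = "\<lambda>_. 50"], goal_cases)
    case 1
    then show ?case using s' by (simp add: J_def store_apply inp_store cnt_def)
  next
    case 2
    then show ?case using s' off_mono[OF i] by (simp add: store_apply)
  next
    case (3 i s v)
    then show ?case by (simp add: J_def store_apply inp_store)
  next
    case (4 i s)
    then show ?case by (auto simp: J_def inp_def)
  next
    case (5 j s'')
    have j: "off i \<le> j" using 5(1) s' by (simp add: store_apply)
    have "s'' ''adj'' = adj" using 5(3) by (simp add: J_def inp_def)
    then show ?case using 5(3,4) cnt_Suc[OF j] by (simp add: J_def store_apply inp_store)
  next
    case (6 t s'')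
    then show ?case
      using low s' deg_off[OF i] by (simp add: J_def store_apply inp_store less_Suc_eq)
  qed
next
  case (6 t s')
  have "(\<Sum>i<n. 80 + 80 * deg i + acost (Var ''n'') + 9) \<le> (\<Sum>v<n. 100 + 100 * deg v)"
    by (rule sum_mono) simp
  then show ?case using 6 by (simp add: lessThan_atLeast0)
qed (use inp g in \<open>auto simp: inp_def store_apply\<close>)

context
  fixes lo :: "nat \<Rightarrow> nat" and K
  assumes K: "\<forall>v<n. K v = 2 * lo v + deg v" and K_le: "\<forall>v<n. K v \<le> 2 * n"
begin

text \<open>The parameters \<open>lo\<close> and \<open>K\<close> stay abstract because they come
  from different orders: \<open>lo\<close> belongs to the search order, \<open>K\<close> is the key
  of the unknown interval order that agrees with it.\<close>

definition low_inv :: "state \<Rightarrow> bool" where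
  "low_inv s \<longleftrightarrow> inp s \<and> (\<forall>v<n. s ''low'' v = lo v)"

lemma low_inv_inp: "low_inv s \<Longrightarrow> inp s"
  by (simp add: low_inv_def)

lemma low_inv_store:
  "x \<notin> {''n'', ''k'', ''off'', ''adj'', ''low''} \<Longrightarrow> low_inv (store s x i m) \<longleftrightarrow> low_inv s"
  by (auto simp: low_inv_def inp_store store_apply)

lemma aval_key:
  "low_inv s \<Longrightarrow> aval a s < n \<Longrightarrow> aval (key_exp a) s = K (aval a s)"
  by (simp add: key_exp_def deg_exp_def K low_inv_def inp_def deg_off)

lemma wp_count:
  assumes "low_inv s"
  shows "wp count_com (\<lambda>t s'. low_inv s' \<and>
    (\<forall>x<2*n+2. s' ''bucket'' x = card {v. v < n \<and> Suc (K v) = x}) \<and> t \<le> 200 * n + 100) s"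
  unfolding count_com_def wp_Seq
proof (rule wp_For[where J = "\<lambda>i s'. low_inv s' \<and> (\<forall>x<i. s' ''bucket'' x = 0)"
      and hi = "2*n+2" and T = "\<lambda>_. 20"], goal_cases)
  case (6 t1 s1)
  show ?case
  proof (rule wp_For[where J = "\<lambda>i s'. low_inv s' \<and>
        (\<forall>x<2*n+2. s' ''bucket'' x = card {v. v < i \<and> Suc (K v) = x})"
        and hi = n and T = "\<lambda>_. 50"], goal_cases)
    case (5 i s')
    then have "aval (key_exp (Var ''i'')) s' = K i" by (subst aval_key) auto
    then show ?case using 5 by (simp add: store_apply low_inv_store card_less_Suc acost_key_exp)
  qed (use 6 in \<open>auto simp: low_inv_store store_apply dest!: low_inv_inp simp: inp_def\<close>)
qed (use assms in \<open>auto simp: low_inv_store store_apply less_Suc_eq dest!: low_inv_inp simp: inp_def\<close>)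

lemma wp_prefix:
  assumes "low_inv s" "\<forall>x<2*n+2. s ''bucket'' x = card {v. v < n \<and> Suc (K v) = x}"
  shows "wp prefix_com (\<lambda>t s'. low_inv s' \<and>
    (\<forall>x<2*n+2. s' ''bucket'' x = card {v. v < n \<and> K v < x}) \<and> t \<le> 200 * n + 100) s"
  unfolding prefix_com_def
proof (rule wp_For[where J = "\<lambda>i s'. low_inv s' \<and> (\<forall>x<2*n+2. s' ''bucket'' x =
        card {v. v < n \<and> (if x \<le> i then K v < x else Suc (K v) = x)})"
        and hi = "2*n+1" and T = "\<lambda>_. 50"], goal_cases)
  case 1
  \<comment> \<open>In cell 0 both readings, prefix count and single count, are zero.\<close>
  have "(if x \<le> 0 then K v < x else Suc (K v) = x) \<longleftrightarrow> Suc (K v) = x" for x v by auto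
  then show ?case using assms by simp
next
  case (5 i s')
  have "{v. v < n \<and> K v < Suc i} = {v. v < n \<and> K v < i} \<union> {v. v < n \<and> Suc (K v) = Suc i}" by auto
  then have "card {v. v < n \<and> K v < Suc i} =
      card {v. v < n \<and> K v < i} + card {v. v < n \<and> Suc (K v) = Suc i}"
    by (simp add: card_Un_disjoint disjoint_iff)
  then show ?case using 5 by (auto simp: store_apply low_inv_store le_Suc_eq)
next
  case (6 t s')
  then show ?case by auto
qed (use assms in \<open>auto simp: low_inv_store store_apply dest!: low_inv_inp simp: inp_def\<close>)

text \<open>A bucket holds the first position of its key plus the number of vertices with that key
  placed so far. As vertices come in increasing number, this is the rank of the next one.\<close>

lemma wp_place:
  assumes "low_inv s" "\<forall>x<2*n+2. s ''bucket'' x = card {v. v < n \<and> K v < x}"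
  shows "wp place_com (\<lambda>t s'. low_inv s' \<and> (\<forall>v<n. s' ''order'' (rank n K v) = v) \<and>
    t \<le> 200 * n + 100) s"
  unfolding place_com_def
proof (rule wp_For[where J = "\<lambda>i s'. low_inv s' \<and> (\<forall>x<2*n+2. s' ''bucket'' x =
        card {v. v < n \<and> K v < x} + card {v. v < i \<and> K v = x}) \<and>
        (\<forall>v\<in>{..<i}. s' ''order'' (rank n K v) = v)"
        and hi = n and T = "\<lambda>_. 80"], goal_cases)
  case (5 i s')
  have i: "i < n" by (rule 5(2))
  then have key: "aval (key_exp (Var ''i'')) s' = K i" using aval_key[of s' "Var ''i''"] 5 by simp
  have "{u. u < n \<and> (K u < K i \<or> K u = K i \<and> u < i)} =
      {v. v < n \<and> K v < K i} \<union> {v. v < i \<and> K v = K i}" using i by auto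
  moreover have "card ({v. v < n \<and> K v < K i} \<union> {v. v < i \<and> K v = K i}) =
      card {v. v < n \<and> K v < K i} + card {v. v < i \<and> K v = K i}"
    by (rule card_Un_disjoint) auto
  ultimately have rk: "rank n K i = card {v. v < n \<and> K v < K i} + card {v. v < i \<and> K v = K i}"
    by (simp only: rank_def)
  have bucket: "s' ''bucket'' (K i) = rank n K i" using rk 5(3) K_le[rule_format, OF i] by simp
  have "rank n K v \<noteq> rank n K i" if "v < i" for v
    using bij_rank[of n K] that i by (auto simp: bij_betw_def inj_on_def)
  then show ?case
    using 5(3,4) key bucket
    by (simp add: store_apply low_inv_store card_less_Suc acost_key_exp lessThan_Suc) (simp add: rk)
next
  case (6 t s')
  then show ?case by auto
qed (use assms in \<open>auto simp: low_inv_store store_apply dest!: low_inv_inp simp: inp_def\<close>)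

lemma wp_color:
  assumes s: "low_inv s" and k: "k > 0"
    and ord: "\<forall>i<n. s ''order'' i < n" "inj_on (s ''order'') {..<n}"
  shows "wp color_com (\<lambda>t s'. s' ''order'' = s ''order'' \<and>
    (\<forall>i<n. s' ''color'' (s ''order'' i) = i mod k) \<and>
    s' ''answer'' 0 = (if \<exists>i<n. i + 2 * k \<le> lo (s ''order'' i) + deg (s ''order'' i) then 0 else 1) \<and>
    t \<le> 200 * n + 100) s"
  unfolding color_com_def wp_Seq wp_Store
proof (rule wp_For[where J = "\<lambda>i s'. low_inv s' \<and> s' ''order'' = s ''order'' \<and>
    (\<forall>j<i. s' ''color'' (s ''order'' j) = j mod k) \<and> s' ''c'' 0 = i mod k \<and>
    s' ''answer'' 0 = (if \<exists>j<i. j + 2 * k \<le> lo (s ''order'' j) + deg (s ''order'' j) then 0 else 1)"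
    and hi = n and T = "\<lambda>_. 100"], goal_cases)
  case (5 i s')
  then have i: "i < n" and s': "inp s'" "low_inv s'" "s' ''order'' = s ''order''" "s' ''c'' 0 = i mod k"
    "s' ''i'' 0 = i" "s' ''off'' = off" "s' ''k'' 0 = k"
    "s' ''answer'' 0 = (if \<exists>j<i. j + 2 * k \<le> lo (s ''order'' j) + deg (s ''order'' j) then 0 else 1)"
    "\<forall>j<i. s' ''color'' (s ''order'' j) = j mod k"
    by (auto simp: low_inv_def inp_def)
  let ?v = "s ''order'' i"
  have v: "s' ''low'' ?v = lo ?v" "off (Suc ?v) - off ?v = deg ?v"
    using ord(1)[rule_format, OF i] s'(2) by (auto simp: low_inv_def deg_off)
  have ne: "s ''order'' j \<noteq> ?v" if "j < i" for j
    using ord(2) that i by (auto simp: inj_on_def)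
  have mod: "(if Suc (i mod k) < k then Suc (i mod k) else 0) = Suc i mod k"
    using k mod_less_divisor[OF k, of i] by (auto simp: mod_Suc)
  have ex: "(\<exists>j<Suc i. P j) \<longleftrightarrow> (\<exists>j<i. P j) \<or> P i" for P by (auto simp: less_Suc_eq)
  have all: "(\<forall>j<Suc i. P j) \<longleftrightarrow> (\<forall>j<i. P j) \<and> P i" for P by (auto simp: less_Suc_eq)
  show ?case
    unfolding ex all mod[symmetric]
    using s'(2-) v ne by (simp add: store_apply low_inv_store deg_exp_def not_less mult_2 add.assoc)
qed (use assms in \<open>auto simp: low_inv_store store_apply dest!: low_inv_inp simp: inp_def\<close>)

end

end

context graph_input
begin

text \<open>Three orders share the same \<open>low\<close>: the computed search positions, an
  unknown interval order \<open>f'\<close> that agrees with them, and the sorted order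
  \<open>g\<close>. Hence values computed for the first are keys of the second and decide edges in
  the third.\<close>

lemma wp_main:
  fixes f :: "nat \<Rightarrow> int"
  assumes inp: "inp s" and f: "umbrella f" and k: "k > 0"
  shows "wp main_com (\<lambda>t s'. \<exists>g::nat \<Rightarrow> nat. umbrella g \<and> bij_betw g {..<n} {..<n} \<and>
    (\<forall>v<n. s' ''order'' (g v) = v \<and> s' ''color'' v = g v mod k) \<and>
    s' ''answer'' 0 = (if \<exists>v<n. g v + 2 * k \<le> low g v + deg v then 0 else 1) \<and>
    t \<le> (\<Sum>v<n. 700 + 700 * deg v) + 950 * n + 700) s"
  unfolding main_com_def wp_Seq
proof (rule wp_mono[OF wp_queue[OF inp f]], elim conjE, goal_cases)
  case q: (1 t1 s1)
  have inj: "inj_on (s1 ''queue'') {..<n}" using q(2) by (simp add: queue_ok_def)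
  show ?case
  proof (rule wp_mono[OF wp_pos[OF q(1) inj]], elim conjE, goal_cases)
    case p: (1 t2 s2)
    let ?h = "s2 ''pos''"
    have bij_h: "bij_betw ?h {..<n} {..<n}"
      using queue_ok_agree(1)[OF q(2), of ?h] p(2) by simp
    obtain f' :: "nat \<Rightarrow> int" where f': "umbrella f'" "agree f' ?h"
      using queue_ok_agree(2)[OF q(2), of ?h] p(2) by auto
    have inj_f': "inj_on f' {..<n}" using f'(1) by (simp add: umbrella_def)
    let ?lo = "low ?h" and ?K = "key f'"
    have K: "\<forall>v<n. ?K v = 2 * ?lo v + deg v"
      using low_agree[OF f'(2) inj_f'] by (simp add: key_def)
    have K_le: "\<forall>v<n. ?K v \<le> 2 * n" using key_le[OF f'(1)] by blast
    define g where "g = rank n ?K"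
    have bij: "bij_betw g {..<n} {..<n}" unfolding g_def by (rule bij_rank)
    have mono: "?K x \<le> ?K y" if "y < n" "g x < g y" for x y
      using rank_mono[OF that(1), of ?K x] that(2) by (simp add: g_def)
    have g: "umbrella g" "agree f' g"
      using sort_by_key[OF f'(1) bij_betw_imp_inj_on[OF bij]] mono by blast+
    have low_g: "low g v = ?lo v" if "v < n" for v
      using low_agree[OF g(2) inj_f' that] low_agree[OF f'(2) inj_f' that] by simp
    show ?case
    proof (rule wp_mono[OF wp_low[OF p(1) refl bij_h]], elim conjE, goal_cases)
      case l: (1 t3 s3)
      have 3: "low_inv ?lo s3" using l by (simp add: low_inv_def[OF K K_le])
      show ?case
      proof (rule wp_mono[OF wp_count[OF K K_le 3]], elim conjE, goal_cases)
        case c: (1 t4 s4)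
        show ?case
        proof (rule wp_mono[OF wp_prefix[OF K K_le c(1,2)]], elim conjE, goal_cases)
          case b: (1 t5 s5)
          show ?case
          proof (rule wp_mono[OF wp_place[OF K K_le b(1,2)]], elim conjE, goal_cases)
            case o: (1 t6 s6)
            have order: "s6 ''order'' (g v) = v" if "v < n" for v
              using o(2) that by (simp add: g_def)
            have surj: "\<exists>v<n. i = g v" if "i < n" for i
              using bij that unfolding bij_betw_def by (metis imageE lessThan_iff)
            have g_less: "g v < n" if "v < n" for v
              using bij that unfolding bij_betw_def by blast
            have ord: "\<forall>i<n. s6 ''order'' i < n" using surj order by metis
            have inj_ord: "inj_on (s6 ''order'') {..<n}"
              by (rule inj_onI) (metis surj order lessThan_iff)
            show ?case
            proof (rule wp_mono[OF wp_color[OF K K_le o(1) k ord inj_ord]], elim conjE, goal_cases)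
              case a: (1 t7 s7)
              have "(\<exists>i<n. i + 2 * k \<le> ?lo (s6 ''order'' i) + deg (s6 ''order'' i)) \<longleftrightarrow>
                (\<exists>v<n. g v + 2 * k \<le> low g v + deg v)"
                (is "(\<exists>i<n. ?P i) \<longleftrightarrow> _")
              proof -
                have P: "?P (g v) \<longleftrightarrow> g v + 2 * k \<le> low g v + deg v" if "v < n" for v
                  using order low_g that by simp
                show ?thesis
                proof
                  assume "\<exists>i<n. ?P i"
                  then obtain i where "i < n" "?P i" by blast
                  moreover from surj[OF this(1)] obtain v where "v < n" "i = g v" by blast
                  ultimately show "\<exists>v<n. g v + 2 * k \<le> low g v + deg v" using P by blast
                qed (use P g_less in blast)
              qed
              moreover have "s7 ''color'' v = g v mod k" if "v < n" for v
                using a(2)[rule_format, OF g_less[OF that]] order[OF that] by simp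
              \<comment> \<open>The 950 is 100 for the queue, 50 for the positions and 200 for each
                of the four last phases.\<close>
              moreover have "t1 + (t2 + (t3 + (t4 + (t5 + (t6 + t7))))) \<le>
                  (\<Sum>v<n. 700 + 700 * deg v) + 950 * n + 700"
              proof -
                have "(\<Sum>v<n. 700 + 700 * deg v) =
                    (\<Sum>v<n. 600 + 600 * deg v) + (\<Sum>v<n. 100 + 100 * deg v)"
                  by (simp add: sum.distrib[symmetric] algebra_simps)
                then show ?thesis
                  using q(3) p(3) l(3) c(3) b(3) o(3) a(4) by linarith
              qed
              ultimately show ?case
                using g(1) bij a(1,3) order by (intro exI[of _ g]) simp
            qed
          qed
        qed
      qed
    qed
  qed
qed

end

section \<open>Edge count and transfer from vertex numbers back to the graph\<close>

text \<open>Adjacent pairs are split by which number is smaller; each half maps injectively into the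
  edges.\<close>

lemma sum_deg_le:
  fixes e :: "nat \<Rightarrow> 'a"
  assumes E: "finite E" and e: "inj_on e {..<n}"
    and A: "\<And>i j. A i j \<Longrightarrow> i < n \<and> j < n \<and> i \<noteq> j \<and> {e i, e j} \<in> E"
  shows "(\<Sum>i<n. card {j. A i j}) \<le> 2 * card E"
proof -
  let ?P = "{(i, j). A i j \<and> i < j}" and ?Q = "{(i, j). A i j \<and> j < i}"
  have eq: "{i, j} = {i', j'}" if "A i j" "A i' j'" "{e i, e j} = {e i', e j'}" for i j i' j'
    using A[OF that(1)] A[OF that(2)] that(3) e by (auto simp: doubleton_eq_iff inj_on_def)
  have inj: "inj_on (\<lambda>(i, j). {e i, e j}) ?P" "inj_on (\<lambda>(i, j). {e i, e j}) ?Q"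
    using eq by (fastforce simp: inj_on_def doubleton_eq_iff)+
  have fin: "finite ?P" "finite ?Q"
    by (rule finite_subset[of _ "{..<n} \<times> {..<n}"]; use A in auto)+
  have "(\<Sum>i<n. card {j. A i j}) = card (SIGMA i:{..<n}. {j. A i j})"
    by (rule card_SigmaI[symmetric]) (use A in \<open>auto intro: finite_subset[of _ "{..<n}"]\<close>)
  also have "(SIGMA i:{..<n}. {j. A i j}) = ?P \<union> ?Q"
    using A by (auto simp: neq_iff)
  also have "card (?P \<union> ?Q) \<le> card ?P + card ?Q" by (rule card_Un_le)
  also have "\<dots> \<le> card E + card E"
    by (intro add_mono card_inj_on_le[OF inj(1)] card_inj_on_le[OF inj(2)]) (use A E in auto)
  finally show ?thesis by simp
qed

lemma main_com_correct:
  fixes V :: "'a set"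
  assumes G: "proper_interval_graph V E" and k: "k > 0" and st: "stores_input V E k e s"
  shows "\<exists>t s' vs c yes. exec main_com s t s' \<and> t \<le> 2000 * (card V + card E + 1) \<and>
    algorithm_run V E k vs c yes \<and> stores_output e vs c yes s'"
proof -
  let ?n = "card V"
  define A where "A i j \<longleftrightarrow> i < ?n \<and> j < ?n \<and> {e i, e j} \<in> E" for i j
  have simple: "simple_graph V E" using G by (simp add: proper_interval_graph_def)
  obtain L R where rep: "proper_interval_rep V E L R"
    using G unfolding proper_interval_graph_def by blast
  have bij: "bij_betw e {..<?n} V" using st by (simp add: stores_input_def)
  have inj: "inj_on e {..<?n}" using bij by (simp add: bij_betw_def)
  have eV: "e i \<in> V" if "i < ?n" for i using bij that by (auto simp: bij_betw_def)
  have irrefl: "\<not> A i i" for i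
  proof
    assume "A i i"
    then have "{e i} \<in> E" by (simp add: A_def)
    then show False using simple by (auto simp: simple_graph_def)
  qed
  interpret graph_input ?n A "s ''off''" "s ''adj''" k
  proof
    fix i assume i: "i < ?n"
    show "s ''off'' i \<le> s ''off'' (Suc i)" using st i by (simp add: stores_input_def)
    have "{j. A i j} = {j. j < ?n \<and> {e i, e j} \<in> E}" using i by (auto simp: A_def)
    then show "bij_betw (s ''adj'') {s ''off'' i..<s ''off'' (Suc i)} {j. A i j}"
      using st i by (simp add: stores_input_def)
  qed (use irrefl in \<open>auto simp: A_def insert_commute\<close>)
  have inp: "inp s" using st by (simp add: inp_def stores_input_def)
  define f where "f v = int (rank ?n (\<lambda>i. L (e i)) v)" for v
  have less: "interval_less L R (e x) (e y)" if "x < ?n" "y < ?n" "f x < f y" for x y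
  proof -
    have "L (e x) \<le> L (e y)"
      using rank_mono[OF that(2), of "\<lambda>i. L (e i)" x] that(3) by (simp add: f_def)
    \<comment> \<open>Of two different intervals with the same left end, the longer would properly
      contain the shorter.\<close>
    moreover have "R (e x) \<le> R (e y)" if "L (e x) = L (e y)"
    proof (rule ccontr)
      assume "\<not> R (e x) \<le> R (e y)"
      moreover have "L (e x) \<le> R (e x)" "L (e y) \<le> R (e y)"
        "\<not> {L (e y)..R (e y)} \<subset> {L (e x)..R (e x)}"
        using rep eV \<open>x < ?n\<close> \<open>y < ?n\<close> unfolding proper_interval_rep_def by blast+
      ultimately show False using that by (auto simp: psubset_eq not_le)
    qed
    ultimately show ?thesis by (auto simp: interval_less_def)
  qed
  have f: "umbrella f"
    unfolding umbrella_def
  proof (intro conjI allI impI)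
    show "inj_on f {..<?n}"
      using bij_rank[of ?n "\<lambda>i. L (e i)"] by (auto simp: f_def bij_betw_def inj_on_def)
    fix x y z assume a: "x < ?n" "y < ?n" "z < ?n" "f x < f y" "f y < f z" "A x z"
    then have "x \<noteq> y" "y \<noteq> z" "x \<noteq> z" by auto
    then have "e x \<noteq> e y" "e y \<noteq> e z" "e x \<noteq> e z"
      using inj a(1-3) by (auto simp: inj_on_def)
    then have "{e x, e y} \<in> E \<and> {e y, e z} \<in> E"
      using proper_interval_rep_umbrella[OF rep eV[OF a(1)] eV[OF a(2)] eV[OF a(3)]]
        less a by (simp add: A_def)
    then show "A x y" "A y z" using a by (auto simp: A_def)
  qed
  obtain t s' and g :: "nat \<Rightarrow> nat" where run: "exec main_com s t s'"
    and g: "umbrella g" "bij_betw g {..<?n} {..<?n}"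
    and out': "\<forall>v<?n. s' ''order'' (g v) = v \<and> s' ''color'' v = g v mod k"
    and answer: "s' ''answer'' 0 = (if \<exists>v<?n. g v + 2 * k \<le> low g v + deg v then 0 else 1)"
    and t: "t \<le> (\<Sum>v<?n. 700 + 700 * deg v) + 950 * ?n + 700"
    using wp_main[OF inp f k] unfolding wp_def by (elim exE conjE)
  have out: "s' ''order'' (g v) = v" "s' ''color'' v = g v mod k" if "v < ?n" for v
    using out' that by auto
  have g_less: "g v < ?n" if "v < ?n" for v using g(2) that by (auto simp: bij_betw_def)
  let ?o = "s' ''order''"
  have o: "?o i < ?n" "g (?o i) = i" if "i < ?n" for i
  proof -
    from that g(2) obtain v where "v < ?n" "i = g v"
      unfolding bij_betw_def by (metis imageE lessThan_iff)
    then show "?o i < ?n" "g (?o i) = i" using out(1) by auto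
  qed
  define vs where "vs = map (\<lambda>i. e (?o i)) [0..<?n]"
  define c where "c v = s' ''color'' (inv_into {..<?n} e v)" for v
  define yes where "yes \<longleftrightarrow> s' ''answer'' 0 = 1"
  have len: "length vs = ?n" and nth: "\<And>i. i < ?n \<Longrightarrow> vs ! i = e (?o i)" by (simp_all add: vs_def)
  have c_e: "c (e v) = s' ''color'' v" if "v < ?n" for v
    using that inj by (simp add: c_def)
  have adj: "{vs ! i, vs ! j} \<in> E \<longleftrightarrow> A (?o i) (?o j)" if "i < ?n" "j < ?n" for i j
    using that o nth by (simp add: A_def)
  have "distinct vs"
  proof -
    have "inj_on (\<lambda>i. e (?o i)) {..<?n}"
    proof (rule inj_onI)
      fix i j assume ij: "i \<in> {..<?n}" "j \<in> {..<?n}" "e (?o i) = e (?o j)"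
      then have "?o i = ?o j" using inj o(1) by (auto simp: inj_on_def)
      then have "g (?o i) = g (?o j)" by (rule arg_cong)
      then show "i = j" using o(2) ij(1,2) by simp
    qed
    then show ?thesis by (simp add: vs_def distinct_map lessThan_atLeast0)
  qed
  moreover have "set vs = V"
  proof -
    have "?o ` {..<?n} = {..<?n}"
    proof
      show "{..<?n} \<subseteq> ?o ` {..<?n}"
      proof
        fix v assume "v \<in> {..<?n}"
        then show "v \<in> ?o ` {..<?n}" using out(1)[of v] g_less[of v] by (intro image_eqI[of _ _ "g v"]) auto
      qed
    qed (use o in auto)
    then have "e ` ?o ` {..<?n} = V" using bij by (simp add: bij_betw_def)
    then show ?thesis by (simp add: vs_def image_image lessThan_atLeast0)
  qed
  moreover have "umbrella_free E vs"
    unfolding umbrella_free_def len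
  proof (intro allI impI, elim conjE)
    fix i j l assume "i < j" "j < l" "l < ?n" "{vs ! i, vs ! l} \<in> E"
    then show "{vs ! i, vs ! j} \<in> E \<and> {vs ! j, vs ! l} \<in> E"
      using umbrellaD[OF g(1), of "?o i" "?o l" "?o j"] adj o by simp
  qed
  moreover have color: "c (vs ! i) = i mod k" if "i < ?n" for i
    using that c_e out(2) o nth by simp
  ultimately interpret cyclic_coloring V E vs k c
    by unfold_locales (use simple k len in auto)
  have "(\<exists>i. i + 2 * k < length vs \<and> {vs ! i, vs ! (i + 2 * k)} \<in> E) \<longleftrightarrow>
      (\<exists>v<?n. g v + 2 * k \<le> low g v + deg v)"
  proof
    assume "\<exists>i. i + 2 * k < length vs \<and> {vs ! i, vs ! (i + 2 * k)} \<in> E"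
    then obtain i where i: "i + 2 * k < ?n" "A (?o i) (?o (i + 2 * k))" using adj len by auto
    then have "i + 2 * k \<le> low g (?o i) + deg (?o i)"
      using A_iff_le[OF g, of "?o i" "?o (i + 2 * k)"] o k by simp
    then show "\<exists>v<?n. g v + 2 * k \<le> low g v + deg v" using o[of i] i by (intro exI[of _ "?o i"]) simp
  next
    assume "\<exists>v<?n. g v + 2 * k \<le> low g v + deg v"
    then obtain v where v: "v < ?n" "g v + 2 * k \<le> low g v + deg v" by blast
    let ?j = "g v + 2 * k"
    \<comment> \<open>\<open>low g v + deg v\<close> is a position of the order, below
      \<open>card V\<close>, so a successful test never points past the end.\<close>
    have j: "?j < ?n" using partition[OF g(1) v(1)] v(2) by simp
    then have "A v (?o ?j)" using A_iff_le[OF g v(1), of "?o ?j"] o v k by simp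
    then show "\<exists>i. i + 2 * k < length vs \<and> {vs ! i, vs ! (i + 2 * k)} \<in> E"
      using adj[of "g v" ?j] g_less[OF v(1)] out(1)[OF v(1)] j len by auto
  qed
  then have "yes \<longleftrightarrow> \<not> (\<exists>j<k. has_cycle (induced_edges E (color_class V c j)))"
    unfolding has_cycle_iff yes_def answer by simp
  then have "algorithm_run V E k vs c yes"
    unfolding algorithm_run_def using umbrella_free_interval_sorted d V u color len by simp
  moreover have "stores_output e vs c yes s'"
    unfolding stores_output_def len using o nth c_e answer by (simp add: yes_def)
  \<comment> \<open>Degrees sum to at most \<open>2 * card E\<close>, so the cost is at most
    \<open>1650 * card V + 1400 * card E + 700\<close>.\<close>
  moreover have "t \<le> 2000 * (?n + card E + 1)"
  proof -
    have "E \<subseteq> Pow V" "finite V" using simple by (auto simp: simple_graph_def)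
    then have "finite E" by (meson finite_Pow_iff finite_subset)
    then have "(\<Sum>v<?n. deg v) \<le> 2 * card E"
      unfolding deg_def by (rule sum_deg_le[OF _ inj]) (use irrefl in \<open>auto simp: A_def\<close>)
    moreover have "(\<Sum>v<?n. 700 + 700 * deg v) = 700 * ?n + 700 * (\<Sum>v<?n. deg v)"
      by (simp add: sum.distrib sum_distrib_left)
    ultimately show ?thesis using t by simp
  qed
  ultimately show ?thesis using run by blast
qed

theorem theorem5:
  "(\<exists>P C. \<forall>(V :: 'a set) E k e s.
      proper_interval_graph V E \<and> k > 0 \<and> stores_input V E k e s \<longrightarrow>
      (\<exists>t s' vs c yes. exec P s t s' \<and> t \<le> C * (card V + card E + 1) \<and>
         algorithm_run V E k vs c yes \<and> stores_output e vs c yes s'))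
   \<and> (\<forall>(V :: 'a set) E k vs c yes.
      proper_interval_graph V E \<and> k > 0 \<and> algorithm_run V E k vs c yes \<longrightarrow>
      (yes \<longleftrightarrow> (\<exists>c'. equitable_tree_coloring V E k c')) \<and>
      (yes \<longrightarrow> equitable_tree_coloring V E k c))"
proof (intro conjI)
  show "\<exists>P C. \<forall>(V :: 'a set) E k e s.
      proper_interval_graph V E \<and> k > 0 \<and> stores_input V E k e s \<longrightarrow>
      (\<exists>t s' vs c yes. exec P s t s' \<and> t \<le> C * (card V + card E + 1) \<and>
         algorithm_run V E k vs c yes \<and> stores_output e vs c yes s')"
    using main_com_correct by blast
  show "\<forall>(V :: 'a set) E k vs c yes.
      proper_interval_graph V E \<and> k > 0 \<and> algorithm_run V E k vs c yes \<longrightarrow>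
      (yes \<longleftrightarrow> (\<exists>c'. equitable_tree_coloring V E k c')) \<and>
      (yes \<longrightarrow> equitable_tree_coloring V E k c)"
    using algorithm_run_correct by blast
qed

end
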